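(* Let $\mathcal C$ be a $\mathcal Z$-prenormal category. If $C$ is an object of $\mathcal C$, then the slice category $\mathcal C/C$ is $(\mathcal Z/C)$-prenormal. If $\mathcal B$ is any category, then the functor category $[\mathcal B,\mathcal C]$ is $[\mathcal B,\mathcal Z]$-prenormal.
   Context: Let $\mathcal C$ be a category and $\mathcal Z$ a class of objects, identified with the full subcategory it spans. A morphism is $\mathcal Z$-trivial if it factors through an object of $\mathcal Z$. A $\mathcal Z$-kernel of $f\colon A\to B$ is a morphism $k\colon K\to A$ such that $f\circ k$ is $\mathcal Z$-trivial and every $x\colon X\to A$ with $f\circ x$ $\mathcal Z$-trivial factors uniquely through $k$; $\mathcal Z$-cokernels are defined dually. A $\mathcal Z$-normal epimorphism is a morphism that is a $\mathcal Z$-cokernel of some morphism. $\mathcal Z$ is mono-coreflective in $\mathcal C$ if it is a full coreflective subcategory, closed under isomorphisms, whose coreflection counits $SX\to X$ are monomorphisms. $\mathcal C$ is $\mathcal Z$-prenormal if: (0) $\mathcal Z$ is mono-coreflective in $\mathcal C$; (1) $\mathcal C$ has finite limits; (2) every $\mathcal Z$-kernel has a $\mathcal Z$-cokernel; (3) $\mathcal Z$-normal epimorphisms are stable under pullback along arbitrary morphisms. $\mathcal Z/C$ is the full subcategory of $\mathcal C/C$ on the objects $x\colon X\to C$ with $X$ in $\mathcal Z$. $[\mathcal B,\mathcal Z]$ is the full subcategory of $[\mathcal B,\mathcal C]$ on the functors taking values in $\mathcal Z$. *)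

theory Defs
  imports "HOL-Library.FuncSet"
begin

section \<open>Categories\<close>

record ('o, 'a) category =
  Obj :: "'o set"
  Arr :: "'a set"
  Dom :: "'a \<Rightarrow> 'o"
  Cod :: "'a \<Rightarrow> 'o"
  Id :: "'o \<Rightarrow> 'a"
  Comp :: "'a \<Rightarrow> 'a \<Rightarrow> 'a" (infixl "\<cdot>\<index>" 70)

definition hom :: "('o, 'a) category \<Rightarrow> 'o \<Rightarrow> 'o \<Rightarrow> 'a set" where
  "hom C x y = {f \<in> Arr C. Dom C f = x \<and> Cod C f = y}"

locale category =
  fixes C :: "('o, 'a) category" (structure)
  assumes dom_in_obj: "f \<in> Arr C \<Longrightarrow> Dom C f \<in> Obj C"
    and cod_in_obj: "f \<in> Arr C \<Longrightarrow> Cod C f \<in> Obj C"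
    and id_in_hom: "x \<in> Obj C \<Longrightarrow> Id C x \<in> hom C x x"
    and comp_in_hom: "\<lbrakk>f \<in> hom C x y; g \<in> hom C y z\<rbrakk> \<Longrightarrow> g \<cdot> f \<in> hom C x z"
    and comp_id_right: "f \<in> hom C x y \<Longrightarrow> f \<cdot> Id C x = f"
    and comp_id_left: "f \<in> hom C x y \<Longrightarrow> Id C y \<cdot> f = f"
    and comp_assoc: "\<lbrakk>f \<in> hom C w x; g \<in> hom C x y; h \<in> hom C y z\<rbrakk>
                     \<Longrightarrow> h \<cdot> g \<cdot> f = h \<cdot> (g \<cdot> f)"

definition is_mono :: "('o, 'a) category \<Rightarrow> 'a \<Rightarrow> bool" where
  "is_mono C m \<longleftrightarrow> m \<in> Arr C \<and>
     (\<forall>x. \<forall>f \<in> hom C x (Dom C m). \<forall>g \<in> hom C x (Dom C m).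
        m \<cdot>\<^bsub>C\<^esub> f = m \<cdot>\<^bsub>C\<^esub> g \<longrightarrow> f = g)"

definition isomorphic :: "('o, 'a) category \<Rightarrow> 'o \<Rightarrow> 'o \<Rightarrow> bool" where
  "isomorphic C x y \<longleftrightarrow> x \<in> Obj C \<and> y \<in> Obj C \<and>
     (\<exists>f \<in> hom C x y. \<exists>g \<in> hom C y x. g \<cdot>\<^bsub>C\<^esub> f = Id C x \<and> f \<cdot>\<^bsub>C\<^esub> g = Id C y)"

definition full_subcategory :: "('o, 'a) category \<Rightarrow> 'o set \<Rightarrow> ('o, 'a) category" where
  "full_subcategory C Z =
     C\<lparr>Obj := Obj C \<inter> Z, Arr := {f \<in> Arr C. Dom C f \<in> Z \<and> Cod C f \<in> Z}\<rparr>"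


section \<open>Functors, natural transformations and adjunctions\<close>

record ('o, 'a, 'p, 'b) functor_data =
  fobj :: "'o \<Rightarrow> 'p"
  farr :: "'a \<Rightarrow> 'b"

definition is_functor ::
  "('o, 'a) category \<Rightarrow> ('p, 'b) category \<Rightarrow> ('o, 'a, 'p, 'b) functor_data \<Rightarrow> bool" where
  "is_functor A B F \<longleftrightarrow> category A \<and> category B \<and>
     (\<forall>x \<in> Obj A. fobj F x \<in> Obj B) \<and>
     (\<forall>f \<in> Arr A. farr F f \<in> hom B (fobj F (Dom A f)) (fobj F (Cod A f))) \<and>
     (\<forall>x \<in> Obj A. farr F (Id A x) = Id B (fobj F x)) \<and>
     (\<forall>f \<in> Arr A. \<forall>g \<in> Arr A. Cod A f = Dom A g \<longrightarrow>
        farr F (g \<cdot>\<^bsub>A\<^esub> f) = farr F g \<cdot>\<^bsub>B\<^esub> farr F f)"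

definition is_nat_trans ::
  "('o, 'a) category \<Rightarrow> ('p, 'b) category \<Rightarrow> ('o, 'a, 'p, 'b) functor_data \<Rightarrow>
   ('o, 'a, 'p, 'b) functor_data \<Rightarrow> ('o \<Rightarrow> 'b) \<Rightarrow> bool" where
  "is_nat_trans A B F G \<tau> \<longleftrightarrow> is_functor A B F \<and> is_functor A B G \<and>
     (\<forall>x \<in> Obj A. \<tau> x \<in> hom B (fobj F x) (fobj G x)) \<and>
     (\<forall>f \<in> Arr A. \<tau> (Cod A f) \<cdot>\<^bsub>B\<^esub> farr F f = farr G f \<cdot>\<^bsub>B\<^esub> \<tau> (Dom A f))"

text \<open>Functor records do not carry their source and target, so this is also the inclusion
  functor of every subcategory.\<close>

definition identity_functor :: "('o, 'a, 'o, 'a) functor_data" where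
  "identity_functor = \<lparr>fobj = (\<lambda>x. x), farr = (\<lambda>f. f)\<rparr>"

definition compose_functor ::
  "('p, 'b, 'q, 'c) functor_data \<Rightarrow> ('o, 'a, 'p, 'b) functor_data \<Rightarrow>
   ('o, 'a, 'q, 'c) functor_data" where
  "compose_functor G F = \<lparr>fobj = fobj G \<circ> fobj F, farr = farr G \<circ> farr F\<rparr>"

text \<open>\<open>L : A \<rightarrow> B\<close> is left adjoint to \<open>R : B \<rightarrow> A\<close> with counit \<open>\<epsilon>\<close>, in terms of the universal
  property of the counit.\<close>

definition is_adjunction ::
  "('o, 'a) category \<Rightarrow> ('p, 'b) category \<Rightarrow> ('o, 'a, 'p, 'b) functor_data \<Rightarrow>
   ('p, 'b, 'o, 'a) functor_data \<Rightarrow> ('p \<Rightarrow> 'b) \<Rightarrow> bool" where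
  "is_adjunction A B L R \<epsilon> \<longleftrightarrow> is_functor A B L \<and> is_functor B A R \<and>
     is_nat_trans B B (compose_functor L R) identity_functor \<epsilon> \<and>
     (\<forall>x \<in> Obj A. \<forall>y \<in> Obj B. \<forall>f \<in> hom B (fobj L x) y.
        \<exists>!g. g \<in> hom A x (fobj R y) \<and> \<epsilon> y \<cdot>\<^bsub>B\<^esub> farr L g = f)"


section \<open>Limits\<close>

definition is_cone ::
  "('i, 'j) category \<Rightarrow> ('o, 'a) category \<Rightarrow> ('i, 'j, 'o, 'a) functor_data \<Rightarrow>
   'o \<Rightarrow> ('i \<Rightarrow> 'a) \<Rightarrow> bool" where
  "is_cone J C D x p \<longleftrightarrow> x \<in> Obj C \<and>
     (\<forall>i \<in> Obj J. p i \<in> hom C x (fobj D i)) \<and>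
     (\<forall>u \<in> Arr J. farr D u \<cdot>\<^bsub>C\<^esub> p (Dom J u) = p (Cod J u))"

definition is_limit ::
  "('i, 'j) category \<Rightarrow> ('o, 'a) category \<Rightarrow> ('i, 'j, 'o, 'a) functor_data \<Rightarrow>
   'o \<Rightarrow> ('i \<Rightarrow> 'a) \<Rightarrow> bool" where
  "is_limit J C D l p \<longleftrightarrow> is_cone J C D l p \<and>
     (\<forall>x q. is_cone J C D x q \<longrightarrow>
        (\<exists>!h. h \<in> hom C x l \<and> (\<forall>i \<in> Obj J. p i \<cdot>\<^bsub>C\<^esub> h = q i)))"

text \<open>Every finite category is isomorphic to one whose objects and arrows are natural numbers,
  so restricting the index category to the type \<open>nat\<close> loses no finite diagram shape (the empty
  one included).\<close>

definition has_finite_limits :: "('o, 'a) category \<Rightarrow> bool" where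
  "has_finite_limits C \<longleftrightarrow>
     (\<forall>(J :: (nat, nat) category) D.
        category J \<and> finite (Obj J) \<and> finite (Arr J) \<and> is_functor J C D \<longrightarrow>
        (\<exists>l p. is_limit J C D l p))"

text \<open>\<open>f'\<close> is a pullback of \<open>f\<close> along \<open>g\<close>:
  the square \<open>f \<cdot> g' = g \<cdot> f'\<close> is a pullback square.\<close>

definition is_pullback :: "('o, 'a) category \<Rightarrow> 'a \<Rightarrow> 'a \<Rightarrow> 'a \<Rightarrow> 'a \<Rightarrow> bool" where
  "is_pullback C f g g' f' \<longleftrightarrow>
     f \<in> Arr C \<and> g \<in> Arr C \<and> g' \<in> Arr C \<and> f' \<in> Arr C \<and>
     Cod C f = Cod C g \<and> Dom C g' = Dom C f' \<and> Cod C g' = Dom C f \<and> Cod C f' = Dom C g \<and>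
     f \<cdot>\<^bsub>C\<^esub> g' = g \<cdot>\<^bsub>C\<^esub> f' \<and>
     (\<forall>x. \<forall>u \<in> hom C x (Dom C f). \<forall>v \<in> hom C x (Dom C g).
        f \<cdot>\<^bsub>C\<^esub> u = g \<cdot>\<^bsub>C\<^esub> v \<longrightarrow>
        (\<exists>!h. h \<in> hom C x (Dom C f') \<and> g' \<cdot>\<^bsub>C\<^esub> h = u \<and> f' \<cdot>\<^bsub>C\<^esub> h = v))"


section \<open>Prenormal categories\<close>

definition Z_trivial :: "('o, 'a) category \<Rightarrow> 'o set \<Rightarrow> 'a \<Rightarrow> bool" where
  "Z_trivial C Z f \<longleftrightarrow> f \<in> Arr C \<and>
     (\<exists>z \<in> Z. \<exists>g \<in> hom C (Dom C f) z. \<exists>h \<in> hom C z (Cod C f). f = h \<cdot>\<^bsub>C\<^esub> g)"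

definition is_Z_kernel :: "('o, 'a) category \<Rightarrow> 'o set \<Rightarrow> 'a \<Rightarrow> 'a \<Rightarrow> bool" where
  "is_Z_kernel C Z f k \<longleftrightarrow> f \<in> Arr C \<and> k \<in> Arr C \<and> Cod C k = Dom C f \<and>
     Z_trivial C Z (f \<cdot>\<^bsub>C\<^esub> k) \<and>
     (\<forall>x \<in> Arr C. Cod C x = Dom C f \<and> Z_trivial C Z (f \<cdot>\<^bsub>C\<^esub> x) \<longrightarrow>
        (\<exists>!u. u \<in> hom C (Dom C x) (Dom C k) \<and> k \<cdot>\<^bsub>C\<^esub> u = x))"

definition is_Z_cokernel :: "('o, 'a) category \<Rightarrow> 'o set \<Rightarrow> 'a \<Rightarrow> 'a \<Rightarrow> bool" where
  "is_Z_cokernel C Z f q \<longleftrightarrow> f \<in> Arr C \<and> q \<in> Arr C \<and> Dom C q = Cod C f \<and>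
     Z_trivial C Z (q \<cdot>\<^bsub>C\<^esub> f) \<and>
     (\<forall>x \<in> Arr C. Dom C x = Cod C f \<and> Z_trivial C Z (x \<cdot>\<^bsub>C\<^esub> f) \<longrightarrow>
        (\<exists>!u. u \<in> hom C (Cod C q) (Cod C x) \<and> u \<cdot>\<^bsub>C\<^esub> q = x))"

definition is_Z_normal_epi :: "('o, 'a) category \<Rightarrow> 'o set \<Rightarrow> 'a \<Rightarrow> bool" where
  "is_Z_normal_epi C Z q \<longleftrightarrow> (\<exists>f. is_Z_cokernel C Z f q)"

definition mono_coreflective :: "('o, 'a) category \<Rightarrow> 'o set \<Rightarrow> bool" where
  "mono_coreflective C Z \<longleftrightarrow> Z \<subseteq> Obj C \<and>
     (\<forall>x \<in> Z. \<forall>y. isomorphic C x y \<longrightarrow> y \<in> Z) \<and>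
     (\<exists>S \<epsilon>. is_adjunction (full_subcategory C Z) C identity_functor S \<epsilon> \<and>
        (\<forall>x \<in> Obj C. is_mono C (\<epsilon> x)))"

definition prenormal :: "('o, 'a) category \<Rightarrow> 'o set \<Rightarrow> bool" where
  "prenormal C Z \<longleftrightarrow> category C \<and>
     mono_coreflective C Z \<and>
     has_finite_limits C \<and>
     (\<forall>f k. is_Z_kernel C Z f k \<longrightarrow> (\<exists>q. is_Z_cokernel C Z k q)) \<and>
     (\<forall>q g g' q'. is_Z_normal_epi C Z q \<and> is_pullback C q g g' q' \<longrightarrow> is_Z_normal_epi C Z q')"


section \<open>Slice categories and functor categories\<close>

text \<open>Arrows of both kinds of categories are triples (domain, underlying data, codomain), so
  that they determine their domain and codomain.\<close>

definition slice :: "('o, 'a) category \<Rightarrow> 'o \<Rightarrow> ('a, 'a \<times> 'a \<times> 'a) category" where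
  "slice C c = \<lparr>
     Obj = {x \<in> Arr C. Cod C x = c},
     Arr = {(x, f, y). x \<in> Arr C \<and> Cod C x = c \<and> y \<in> Arr C \<and> Cod C y = c \<and>
              f \<in> hom C (Dom C x) (Dom C y) \<and> y \<cdot>\<^bsub>C\<^esub> f = x},
     Dom = (\<lambda>(x, f, y). x),
     Cod = (\<lambda>(x, f, y). y),
     Id = (\<lambda>x. (x, Id C (Dom C x), x)),
     Comp = (\<lambda>(y, g, z) (x, f, y'). (x, g \<cdot>\<^bsub>C\<^esub> f, z))\<rparr>"

definition slice_class :: "('o, 'a) category \<Rightarrow> 'o set \<Rightarrow> 'o \<Rightarrow> 'a set" where
  "slice_class C Z c = {x \<in> Obj (slice C c). Dom C x \<in> Z}"

text \<open>Functors and natural transformations are required to be \<open>extensional\<close>, i.e.\ \<open>undefined\<close>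
  outside the objects and arrows of \<open>B\<close>, so that equality in HOL is equality of functors and
  of natural transformations.\<close>

definition functor_category ::
  "('p, 'b) category \<Rightarrow> ('o, 'a) category \<Rightarrow>
   (('p, 'b, 'o, 'a) functor_data,
    ('p, 'b, 'o, 'a) functor_data \<times> ('p \<Rightarrow> 'a) \<times> ('p, 'b, 'o, 'a) functor_data) category" where
  "functor_category B C =
     (let Fun = {F. is_functor B C F \<and>
                    fobj F \<in> extensional (Obj B) \<and> farr F \<in> extensional (Arr B)} in \<lparr>
     Obj = Fun,
     Arr = {(F, \<tau>, G). F \<in> Fun \<and> G \<in> Fun \<and>
              is_nat_trans B C F G \<tau> \<and> \<tau> \<in> extensional (Obj B)},
     Dom = (\<lambda>(F, \<tau>, G). F),
     Cod = (\<lambda>(F, \<tau>, G). G),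
     Id = (\<lambda>F. (F, (\<lambda>b \<in> Obj B. Id C (fobj F b)), F)),
     Comp = (\<lambda>(G, \<sigma>, H) (F, \<tau>, G'). (F, (\<lambda>b \<in> Obj B. \<sigma> b \<cdot>\<^bsub>C\<^esub> \<tau> b), H))\<rparr>)"

definition functor_class ::
  "('p, 'b) category \<Rightarrow> ('o, 'a) category \<Rightarrow> 'o set \<Rightarrow> ('p, 'b, 'o, 'a) functor_data set" where
  "functor_class B C Z =
     {F \<in> Obj (functor_category B C). \<forall>b \<in> Obj B. fobj F b \<in> Z}"

end

theory Submission
  imports Defs
begin

text \<open>
  Both halves follow from one principle. Let \<open>D\<close> be a category with finite limits and \<open>W\<close> a class of its
  objects closed under isomorphism, and let \<open>U\<^sub>i : D \<rightarrow> C\<close> be functors that preserve pullbacks, carry chosen monic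
  coreflection counits of \<open>W\<close> to such counits of \<open>Z\<close>, reflect cokernels jointly, and lift cokernels of kernels jointly; then prenormality of \<open>C\<close> passes to
  \<open>D\<close> (lemma \<open>prenormal_by_joint_reflection\<close>). For the slice there is a single functor, the
  domain functor \<open>C/c \<rightarrow> C\<close>; for \<open>[B, C]\<close> the functors are the evaluations at the objects of \<open>B\<close>.

  The principle rests on two observations. First, when \<open>Z\<close> is mono-coreflective, a morphism
  \<open>f : A \<rightarrow> Y\<close> is trivial exactly if it factors through the counit \<open>SY \<rightarrow> Y\<close>, so the kernels of
  \<open>f\<close> are the pullbacks of that counit along \<open>f\<close>
  (lemma \<open>kernel_iff_pullback_of_coreflection\<close>); functors preserving pullbacks and counits
  therefore preserve kernels. Second, a normal epimorphism is the cokernel of each of its kernels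
  (lemma \<open>normal_epi_cokernel_of_kernel\<close>). So let \<open>q\<close> be a normal epimorphism of \<open>D\<close> with kernel
  \<open>k\<close>. The cokernel of \<open>k\<close> obtained by lifting is isomorphic to \<open>q\<close>, hence every \<open>U\<^sub>i q\<close> is a
  normal epimorphism of \<open>C\<close>. For a pullback \<open>q'\<close> of \<open>q\<close> each \<open>U\<^sub>i q'\<close> is then normal too, so it is
  the cokernel of \<open>U\<^sub>i k'\<close>, where \<open>k'\<close> is a kernel of \<open>q'\<close>, and by reflection \<open>q'\<close> is the
  cokernel of \<open>k'\<close>. Kernels enter because a cokernel in \<open>C/c\<close> is only
  tested against arrows over \<open>c\<close>, so for an arbitrary arrow it is not evidently a cokernel in \<open>C\<close>.

  In the slice, a cokernel \<open>q : X \<rightarrow> Q\<close> of the kernel of \<open>f : X \<rightarrow> Y\<close> acquires a structure map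
  to \<open>c\<close> because \<open>f\<close> factors through \<open>q\<close> and \<open>Y\<close> lies over \<open>c\<close>
  (lemma \<open>slice_cokernel_lift\<close>). A finite limit of a diagram in \<open>C/c\<close> is the limit in \<open>C\<close> of
  the diagram extended by the vertex \<open>c\<close>. In \<open>[B, C]\<close> coreflections, cokernels and limits are
  formed pointwise, and their action on arrows of \<open>B\<close> is forced by monic, epic or jointly monic
  families (lemma \<open>FC_functor_by_unique_arrows\<close>). That evaluations preserve every pullback, and
  not only the pullbacks constructed pointwise, holds because any two limits of the same diagram
  are isomorphic (lemma \<open>preserves_pullbacks_if_preserves_some_limit\<close>).
\<close>

section \<open>Morphisms, trivial morphisms and universal factorizations\<close>

text \<open>The local form of mono-coreflectivity: \<open>e\<close> is a monic counit at the single object \<open>y\<close>. Requiring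
  mere existence of a factorization gives a universal arrow, since \<open>e\<close> is monic.\<close>

definition coreflection :: "('o, 'a) category \<Rightarrow> 'o set \<Rightarrow> 'o \<Rightarrow> 'a \<Rightarrow> bool" where
  "coreflection C Z y e \<longleftrightarrow> Cod C e = y \<and> Dom C e \<in> Z \<and> is_mono C e \<and>
     (\<forall>f \<in> Arr C. Dom C f \<in> Z \<and> Cod C f = y \<longrightarrow>
        (\<exists>g \<in> hom C (Dom C f) (Dom C e). e \<cdot>\<^bsub>C\<^esub> g = f))"

lemma coreflectionD:
  assumes "coreflection C Z y e"
  shows "e \<in> Arr C" "Cod C e = y" "Dom C e \<in> Z" "is_mono C e"
  using assms by (auto simp: coreflection_def is_mono_def)

lemma coreflection_factor:
  assumes "coreflection C Z y e" "f \<in> Arr C" "Dom C f \<in> Z" "Cod C f = y"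
  obtains g where "g \<in> hom C (Dom C f) (Dom C e)" "e \<cdot>\<^bsub>C\<^esub> g = f"
  using assms by (auto simp: coreflection_def)

lemma pullbackI:
  assumes "f \<in> Arr C" "g \<in> Arr C" "g' \<in> Arr C" "f' \<in> Arr C"
    "Cod C f = Cod C g" "Dom C g' = Dom C f'" "Cod C g' = Dom C f" "Cod C f' = Dom C g"
    "f \<cdot>\<^bsub>C\<^esub> g' = g \<cdot>\<^bsub>C\<^esub> f'"
    "\<And>x u v. \<lbrakk>u \<in> hom C x (Dom C f); v \<in> hom C x (Dom C g); f \<cdot>\<^bsub>C\<^esub> u = g \<cdot>\<^bsub>C\<^esub> v\<rbrakk> \<Longrightarrow>
        (\<exists>!h. h \<in> hom C x (Dom C f') \<and> g' \<cdot>\<^bsub>C\<^esub> h = u \<and> f' \<cdot>\<^bsub>C\<^esub> h = v)"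
  shows "is_pullback C f g g' f'"
  unfolding is_pullback_def by (intro conjI allI ballI impI assms)

lemma cokernelI:
  assumes "f \<in> Arr C" "q \<in> Arr C" "Dom C q = Cod C f" "Z_trivial C Z (q \<cdot>\<^bsub>C\<^esub> f)"
    "\<And>x. \<lbrakk>x \<in> Arr C; Dom C x = Cod C f; Z_trivial C Z (x \<cdot>\<^bsub>C\<^esub> f)\<rbrakk> \<Longrightarrow>
        (\<exists>!u. u \<in> hom C (Cod C q) (Cod C x) \<and> u \<cdot>\<^bsub>C\<^esub> q = x)"
  shows "is_Z_cokernel C Z f q"
  unfolding is_Z_cokernel_def using assms by blast

lemma pullbackD:
  assumes "is_pullback C f g g' f'"
  shows "f \<in> Arr C" "g \<in> Arr C" "g' \<in> Arr C" "f' \<in> Arr C"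
    "Cod C f = Cod C g" "Dom C g' = Dom C f'" "Cod C g' = Dom C f" "Cod C f' = Dom C g"
    "f \<cdot>\<^bsub>C\<^esub> g' = g \<cdot>\<^bsub>C\<^esub> f'"
  using assms by (simp_all add: is_pullback_def)

lemma pullback_factor:
  assumes "is_pullback C f g g' f'"
    "u \<in> hom C x (Dom C f)" "v \<in> hom C x (Dom C g)" "f \<cdot>\<^bsub>C\<^esub> u = g \<cdot>\<^bsub>C\<^esub> v"
  shows "\<exists>!h. h \<in> hom C x (Dom C f') \<and> g' \<cdot>\<^bsub>C\<^esub> h = u \<and> f' \<cdot>\<^bsub>C\<^esub> h = v"
  using assms(1) unfolding is_pullback_def
  by (elim conjE allE[of _ x] ballE[of _ _ u] ballE[of _ _ v]) (use assms(2-) in blast)+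

lemma cokernelD:
  assumes "is_Z_cokernel C Z f q"
  shows "f \<in> Arr C" "q \<in> Arr C" "Dom C q = Cod C f" "Z_trivial C Z (q \<cdot>\<^bsub>C\<^esub> f)"
  using assms by (simp_all add: is_Z_cokernel_def)

lemma cokernel_factor:
  assumes "is_Z_cokernel C Z f q" "x \<in> Arr C" "Dom C x = Cod C f" "Z_trivial C Z (x \<cdot>\<^bsub>C\<^esub> f)"
  shows "\<exists>!u. u \<in> hom C (Cod C q) (Cod C x) \<and> u \<cdot>\<^bsub>C\<^esub> q = x"
  using assms unfolding is_Z_cokernel_def by blast

lemma kernelD:
  assumes "is_Z_kernel C Z f k"
  shows "f \<in> Arr C" "k \<in> Arr C" "Cod C k = Dom C f" "Z_trivial C Z (f \<cdot>\<^bsub>C\<^esub> k)"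
  using assms by (simp_all add: is_Z_kernel_def)

lemma kernel_factor:
  assumes "is_Z_kernel C Z f k" "x \<in> Arr C" "Cod C x = Dom C f" "Z_trivial C Z (f \<cdot>\<^bsub>C\<^esub> x)"
  shows "\<exists>!u. u \<in> hom C (Dom C x) (Dom C k) \<and> k \<cdot>\<^bsub>C\<^esub> u = x"
  using assms unfolding is_Z_kernel_def by blast

context category
begin

lemma hom_iff: "f \<in> hom C x y \<longleftrightarrow> f \<in> Arr C \<and> Dom C f = x \<and> Cod C f = y"
  by (simp add: hom_def)

lemma comp_typing:
  assumes "f \<in> Arr C" "g \<in> Arr C" "Cod C f = Dom C g"
  shows "g \<cdot> f \<in> Arr C" "Dom C (g \<cdot> f) = Dom C f" "Cod C (g \<cdot> f) = Cod C g"
  using comp_in_hom[of f "Dom C f" "Dom C g" g "Cod C g"] assms by (auto simp: hom_iff)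

lemma id_typing:
  assumes "x \<in> Obj C"
  shows "Id C x \<in> Arr C" "Dom C (Id C x) = x" "Cod C (Id C x) = x"
  using id_in_hom[OF assms] by (auto simp: hom_iff)

lemma id_right: "\<lbrakk>f \<in> Arr C; Dom C f = x\<rbrakk> \<Longrightarrow> f \<cdot> Id C x = f"
  using comp_id_right by (auto simp: hom_iff)

lemma id_left: "\<lbrakk>f \<in> Arr C; Cod C f = y\<rbrakk> \<Longrightarrow> Id C y \<cdot> f = f"
  using comp_id_left by (auto simp: hom_iff)

lemma assoc:
  "\<lbrakk>f \<in> Arr C; g \<in> Arr C; h \<in> Arr C; Cod C f = Dom C g; Cod C g = Dom C h\<rbrakk>
   \<Longrightarrow> h \<cdot> g \<cdot> f = h \<cdot> (g \<cdot> f)"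
  using comp_assoc by (auto simp: hom_iff)

lemmas cat_simps = hom_iff comp_typing id_typing id_left id_right dom_in_obj cod_in_obj

lemma mono_cancel:
  "\<lbrakk>is_mono C m; m \<cdot> f = m \<cdot> g; f \<in> Arr C; g \<in> Arr C; Cod C f = Dom C m; Cod C g = Dom C m;
    Dom C f = Dom C g\<rbrakk> \<Longrightarrow> f = g"
  unfolding is_mono_def by (auto simp: hom_iff)

lemma trivialI:
  "\<lbrakk>a \<in> Arr C; b \<in> Arr C; Cod C a = Dom C b; Dom C b \<in> Z\<rbrakk> \<Longrightarrow> Z_trivial C Z (b \<cdot> a)"
  unfolding Z_trivial_def by (intro conjI bexI[of _ "Dom C b"] bexI[of _ a] bexI[of _ b])
    (simp_all add: cat_simps)

lemma trivialE:
  assumes "Z_trivial C Z f"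
  obtains a b where "a \<in> Arr C" "b \<in> Arr C" "Cod C a = Dom C b" "Dom C b \<in> Z"
    "Dom C a = Dom C f" "Cod C b = Cod C f" "b \<cdot> a = f"
  using assms that unfolding Z_trivial_def by (auto simp: hom_iff)

lemma trivial_comp_left:
  assumes "Z_trivial C Z f" "g \<in> Arr C" "Dom C g = Cod C f"
  shows "Z_trivial C Z (g \<cdot> f)"
proof -
  obtain a b where ab: "a \<in> Arr C" "b \<in> Arr C" "Cod C a = Dom C b" "Dom C b \<in> Z"
    "Dom C a = Dom C f" "Cod C b = Cod C f" "b \<cdot> a = f"
    using assms(1) by (rule trivialE)
  have "Z_trivial C Z ((g \<cdot> b) \<cdot> a)"
    using ab assms(2,3) by (intro trivialI) (simp_all add: cat_simps)
  then show ?thesis using ab assms(2,3) by (simp add: assoc)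
qed

lemma trivial_comp_right:
  assumes "Z_trivial C Z f" "g \<in> Arr C" "Cod C g = Dom C f"
  shows "Z_trivial C Z (f \<cdot> g)"
proof -
  obtain a b where ab: "a \<in> Arr C" "b \<in> Arr C" "Cod C a = Dom C b" "Dom C b \<in> Z"
    "Dom C a = Dom C f" "Cod C b = Cod C f" "b \<cdot> a = f"
    using assms(1) by (rule trivialE)
  have "Z_trivial C Z (b \<cdot> (a \<cdot> g))"
    using ab assms(2,3) by (intro trivialI) (simp_all add: cat_simps)
  then show ?thesis using ab assms(2,3) by (simp flip: assoc)
qed

subsection \<open>Coreflections one object at a time\<close>

lemma full_subcategory_category:
  assumes "Z \<subseteq> Obj C"
  shows "category (full_subcategory C Z)"
  by unfold_locales
    (use assms in \<open>auto simp: full_subcategory_def hom_def cat_simps assoc\<close>)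

text \<open>A choice of monic counits at all objects makes a functor \<open>S\<close>: the arrow \<open>S f\<close> is the unique
  factorization of \<open>f \<cdot> e\<close> through the next counit, and functoriality and naturality are forced by
  cancelling that counit.\<close>

lemma mono_coreflectiveI:
  assumes Z: "Z \<subseteq> Obj C"
    and iso: "\<And>x y. \<lbrakk>x \<in> Z; isomorphic C x y\<rbrakk> \<Longrightarrow> y \<in> Z"
    and core: "\<And>y. y \<in> Obj C \<Longrightarrow> \<exists>e. coreflection C Z y e"
  shows "mono_coreflective C Z"
proof -
  have C: "category C" by unfold_locales
  let ?Z = "full_subcategory C Z"
  obtain e where e: "\<And>y. y \<in> Obj C \<Longrightarrow> coreflection C Z y (e y)"
    using core by metis
  note e' = e[THEN coreflectionD(1)] e[THEN coreflectionD(2)] e[THEN coreflectionD(3)]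
    e[THEN coreflectionD(4)]
  have "\<exists>g. g \<in> hom C (Dom C (e (Dom C f))) (Dom C (e (Cod C f))) \<and>
      e (Cod C f) \<cdot> g = f \<cdot> e (Dom C f)" if "f \<in> Arr C" for f
    using that coreflection_factor[OF e, of "Cod C f" "f \<cdot> e (Dom C f)"] e'
    by (simp add: cat_simps) metis
  then obtain s where s: "\<And>f. f \<in> Arr C \<Longrightarrow>
      s f \<in> hom C (Dom C (e (Dom C f))) (Dom C (e (Cod C f)))"
    and es: "\<And>f. f \<in> Arr C \<Longrightarrow> e (Cod C f) \<cdot> s f = f \<cdot> e (Dom C f)"
    by metis
  have s': "s f \<in> Arr C" "Dom C (s f) = Dom C (e (Dom C f))" "Cod C (s f) = Dom C (e (Cod C f))"
    if "f \<in> Arr C" for f using s[OF that] by (auto simp: hom_iff)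
  let ?S = "\<lparr>fobj = (\<lambda>y. Dom C (e y)), farr = s\<rparr>"
  have Zcat: "category ?Z" using full_subcategory_category[OF Z] .
  have s_id: "s (Id C x) = Id C (Dom C (e x))" if x: "x \<in> Obj C" for x
    by (rule mono_cancel[OF e'(4)[OF x]])
      (use es[of "Id C x"] x s'[of "Id C x"] e'[of x] in \<open>auto simp: cat_simps\<close>)
  have s_comp: "s (g \<cdot> f) = s g \<cdot> s f"
    if f: "f \<in> Arr C" and g: "g \<in> Arr C" and fg: "Cod C f = Dom C g" for f g
  proof (rule mono_cancel[OF e'(4)[of "Cod C g"]])
    have "e (Cod C g) \<cdot> s (g \<cdot> f) = (g \<cdot> f) \<cdot> e (Dom C f)"
      using es[of "g \<cdot> f"] f g fg by (simp add: cat_simps)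
    also have "\<dots> = g \<cdot> (e (Cod C f) \<cdot> s f)"
      using f g fg e' es[OF f] by (simp add: cat_simps assoc)
    also have "\<dots> = (e (Cod C g) \<cdot> s g) \<cdot> s f"
      using f g fg e' es[OF g] s' by (simp add: cat_simps flip: assoc)
    finally show "e (Cod C g) \<cdot> s (g \<cdot> f) = e (Cod C g) \<cdot> (s g \<cdot> s f)"
      using f g fg e' s' by (simp add: cat_simps assoc)
  qed (use f g fg e' s' in \<open>auto simp: cat_simps\<close>)
  have L: "is_functor ?Z C identity_functor"
    using C Zcat unfolding is_functor_def full_subcategory_def identity_functor_def
    by (auto simp: hom_iff)
  have R: "is_functor C ?Z ?S"
    using C Zcat s_id s_comp e' s' Z unfolding is_functor_def full_subcategory_def
    by (auto simp: cat_simps hom_def)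
  have LR: "is_functor C C (compose_functor identity_functor ?S)"
    using C s_id s_comp e' s' Z
    unfolding is_functor_def compose_functor_def identity_functor_def
    by (auto simp: cat_simps)
  have I: "is_functor C C identity_functor"
    using C unfolding is_functor_def identity_functor_def by (auto simp: cat_simps)
  have nat: "is_nat_trans C C (compose_functor identity_functor ?S) identity_functor e"
    using LR I e' es
    unfolding is_nat_trans_def by (auto simp: cat_simps compose_functor_def identity_functor_def)
  have univ: "\<exists>!g. g \<in> hom ?Z x (fobj ?S y) \<and> e y \<cdot> farr identity_functor g = f"
    if x: "x \<in> Obj ?Z" and y: "y \<in> Obj C" and f: "f \<in> hom C (fobj identity_functor x) y"
    for x y f
  proof -
    have xZ: "x \<in> Z" using x by (auto simp: full_subcategory_def)
    obtain g where g: "g \<in> hom C x (Dom C (e y))" "e y \<cdot> g = f"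
      using coreflection_factor[OF e[OF y], of f] f xZ by (auto simp: identity_functor_def hom_iff)
    show ?thesis
    proof
      show "g \<in> hom ?Z x (fobj ?S y) \<and> e y \<cdot> farr identity_functor g = f"
        using g xZ e'(3)[OF y] by (auto simp: full_subcategory_def identity_functor_def hom_def)
    next
      fix g' assume g': "g' \<in> hom ?Z x (fobj ?S y) \<and> e y \<cdot> farr identity_functor g' = f"
      show "g' = g"
        by (rule mono_cancel[OF e'(4)[OF y]])
          (use g g' in \<open>auto simp: full_subcategory_def identity_functor_def hom_def\<close>)
    qed
  qed
  have "is_adjunction ?Z C identity_functor ?S e"
    unfolding is_adjunction_def using L R nat univ by blast
  then show ?thesis
    unfolding mono_coreflective_def using Z iso e'(4) by blast
qed

lemma mono_coreflectiveD:
  assumes "mono_coreflective C Z" and y: "y \<in> Obj C"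
  obtains e where "coreflection C Z y e"
proof -
  obtain S \<epsilon> where adj: "is_adjunction (full_subcategory C Z) C identity_functor S \<epsilon>"
    and mono: "is_mono C (\<epsilon> y)"
    using assms unfolding mono_coreflective_def by blast
  have Sy: "fobj S y \<in> Z" "fobj S y \<in> Obj C" and ey: "\<epsilon> y \<in> hom C (fobj S y) y"
    using adj y
    unfolding is_adjunction_def is_nat_trans_def is_functor_def compose_functor_def
      identity_functor_def full_subcategory_def by auto
  have univ: "\<forall>x \<in> Obj (full_subcategory C Z). \<forall>y \<in> Obj C. \<forall>f \<in> hom C x y.
      \<exists>!g. g \<in> hom (full_subcategory C Z) x (fobj S y) \<and> \<epsilon> y \<cdot> g = f"
    using adj unfolding is_adjunction_def identity_functor_def by simp
  have "\<exists>g \<in> hom C (Dom C f) (fobj S y). \<epsilon> y \<cdot> g = f"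
    if f: "f \<in> Arr C" "Dom C f \<in> Z" "Cod C f = y" for f
  proof -
    have "Dom C f \<in> Obj (full_subcategory C Z)" "f \<in> hom C (Dom C f) y"
      using f by (auto simp: full_subcategory_def cat_simps)
    from univ[rule_format, OF this(1) y this(2)] show ?thesis
      by (auto simp: full_subcategory_def hom_def)
  qed
  then have "coreflection C Z y (\<epsilon> y)"
    using mono ey Sy unfolding coreflection_def by (auto simp: hom_iff)
  then show ?thesis using that by blast
qed

subsection \<open>Kernels and cokernels\<close>

text \<open>An arrow from an object of \<open>Z\<close> factors through the counit, hence so does every arrow that
  factors through an object of \<open>Z\<close>; the counit itself starts in \<open>Z\<close>.\<close>

lemma trivial_iff_factors_through_coreflection:
  assumes "coreflection C Z (Cod C f) e"
  shows "Z_trivial C Z f \<longleftrightarrow> f \<in> Arr C \<and> (\<exists>g \<in> hom C (Dom C f) (Dom C e). f = e \<cdot> g)"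
proof
  assume f: "Z_trivial C Z f"
  then obtain a b where ab: "a \<in> Arr C" "b \<in> Arr C" "Cod C a = Dom C b" "Dom C b \<in> Z"
    "Dom C a = Dom C f" "Cod C b = Cod C f" "b \<cdot> a = f"
    by (rule trivialE)
  obtain c where c: "c \<in> hom C (Dom C b) (Dom C e)" "e \<cdot> c = b"
    using coreflection_factor[OF assms ab(2,4,6)] .
  have "e \<cdot> (c \<cdot> a) = f"
    using ab c coreflectionD[OF assms] by (simp add: hom_iff flip: assoc)
  moreover have "c \<cdot> a \<in> hom C (Dom C f) (Dom C e)"
    using ab c by (simp add: cat_simps)
  ultimately show "f \<in> Arr C \<and> (\<exists>g \<in> hom C (Dom C f) (Dom C e). f = e \<cdot> g)"
    using f unfolding Z_trivial_def by blast
next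
  assume "f \<in> Arr C \<and> (\<exists>g \<in> hom C (Dom C f) (Dom C e). f = e \<cdot> g)"
  then obtain g where "g \<in> hom C (Dom C f) (Dom C e)" "f = e \<cdot> g" by blast
  then show "Z_trivial C Z f"
    using coreflectionD[OF assms] trivialI[of g e Z] by (simp add: hom_iff)
qed

text \<open>Since \<open>f \<cdot> x\<close> is trivial iff \<open>f \<cdot> x = e \<cdot> v\<close> for some \<open>v\<close>, and \<open>v\<close> is unique because \<open>e\<close> is
  monic, the universal property of a kernel and that of the pullback of \<open>e\<close> along \<open>f\<close> quantify
  over the same data.\<close>

lemma kernel_iff_pullback_of_coreflection:
  assumes e: "coreflection C Z (Cod C f) e"
  shows "is_Z_kernel C Z f k \<longleftrightarrow> (\<exists>k'. is_pullback C f e k k')"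
proof
  note eD = coreflectionD[OF e]
  assume k: "is_Z_kernel C Z f k"
  note fk = kernelD[OF k]
  obtain k' where k': "k' \<in> Arr C" "Dom C k' = Dom C k" "Cod C k' = Dom C e" "f \<cdot> k = e \<cdot> k'"
    using fk e by (auto simp: trivial_iff_factors_through_coreflection comp_typing hom_iff)
  have "\<exists>!h. h \<in> hom C x (Dom C k') \<and> k \<cdot> h = u \<and> k' \<cdot> h = v"
    if u: "u \<in> hom C x (Dom C f)" and v: "v \<in> hom C x (Dom C e)" and uv: "f \<cdot> u = e \<cdot> v" for x u v
  proof -
    have u': "u \<in> Arr C" "Dom C u = x" "Cod C u = Dom C f"
      and v': "v \<in> Arr C" "Dom C v = x" "Cod C v = Dom C e"
      using u v by (simp_all add: hom_iff)
    have "Z_trivial C Z (f \<cdot> u)"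
      using trivialI[of v e Z] uv v' eD by simp
    from kernel_factor[OF k u'(1,3) this]
    have ex: "\<exists>!h. h \<in> hom C x (Dom C k) \<and> k \<cdot> h = u" by (simp add: u')
    have "k' \<cdot> h = v" if h: "h \<in> hom C x (Dom C k)" "k \<cdot> h = u" for h
    proof (rule mono_cancel[OF eD(4)])
      have "e \<cdot> (k' \<cdot> h) = f \<cdot> k \<cdot> h"
        using k' h(1) eD by (simp add: hom_iff assoc)
      also have "\<dots> = e \<cdot> v" using uv h fk by (simp add: hom_iff assoc)
      finally show "e \<cdot> (k' \<cdot> h) = e \<cdot> v" .
    qed (use k' h(1) v' eD in \<open>simp_all add: cat_simps\<close>)
    then show ?thesis using ex k'(2) by metis
  qed
  then show "\<exists>k'. is_pullback C f e k k'"
    using fk k' eD by (intro exI[of _ k'] pullbackI) (simp_all add: hom_iff)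
next
  note eD = coreflectionD[OF e]
  assume "\<exists>k'. is_pullback C f e k k'"
  then obtain k' where pb: "is_pullback C f e k k'" ..
  note fk = pullbackD[OF pb]
  have "Z_trivial C Z (f \<cdot> k)"
    using trivialI[of k' e Z] fk eD by simp
  moreover have "\<exists>!u. u \<in> hom C (Dom C x) (Dom C k) \<and> k \<cdot> u = x"
    if x: "x \<in> Arr C" "Cod C x = Dom C f" "Z_trivial C Z (f \<cdot> x)" for x
  proof -
    have "coreflection C Z (Cod C (f \<cdot> x)) e" using e x fk by (simp add: comp_typing)
    then obtain v where v: "v \<in> hom C (Dom C x) (Dom C e)" "f \<cdot> x = e \<cdot> v"
      using x fk by (auto simp: trivial_iff_factors_through_coreflection comp_typing)
    have "x \<in> hom C (Dom C x) (Dom C f)" using x by (simp add: hom_iff)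
    from pullback_factor[OF pb this v]
    have ex: "\<exists>!h. h \<in> hom C (Dom C x) (Dom C k) \<and> k \<cdot> h = x \<and> k' \<cdot> h = v"
      by (simp add: fk)
    have "k' \<cdot> h = v" if h: "h \<in> hom C (Dom C x) (Dom C k)" "k \<cdot> h = x" for h
    proof (rule mono_cancel[OF eD(4)])
      have "e \<cdot> (k' \<cdot> h) = f \<cdot> k \<cdot> h"
        using fk h(1) eD by (simp add: hom_iff assoc)
      also have "\<dots> = e \<cdot> v" using v h fk(1,3,7) by (simp add: hom_iff assoc)
      finally show "e \<cdot> (k' \<cdot> h) = e \<cdot> v" .
    qed (use fk h(1) v eD in \<open>simp_all add: cat_simps\<close>)
    then show ?thesis using ex by metis
  qed
  ultimately show "is_Z_kernel C Z f k"
    using fk unfolding is_Z_kernel_def by blast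
qed

text \<open>If \<open>u \<cdot> q = v \<cdot> q\<close>, this arrow composed with \<open>f\<close> is trivial because \<open>q \<cdot> f\<close> is, so its
  factorization through \<open>q\<close> is unique.\<close>

lemma cokernel_epi:
  assumes q: "is_Z_cokernel C Z f q"
    and uv: "u \<in> Arr C" "v \<in> Arr C" "Dom C u = Cod C q" "Dom C v = Cod C q"
      "Cod C u = Cod C v" "u \<cdot> q = v \<cdot> q"
  shows "u = v"
proof -
  note qD = cokernelD[OF q]
  have "Z_trivial C Z ((u \<cdot> q) \<cdot> f)"
    using trivial_comp_left[OF qD(4), of u] qD(1-3) uv(1,3) by (simp add: assoc comp_typing)
  from cokernel_factor[OF q _ _ this]
  have "\<exists>!w. w \<in> hom C (Cod C q) (Cod C u) \<and> w \<cdot> q = u \<cdot> q"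
    using uv(1,3) qD by (simp add: comp_typing)
  moreover have "u \<in> hom C (Cod C q) (Cod C u)" "v \<in> hom C (Cod C q) (Cod C u)"
    using uv by (simp_all add: hom_iff)
  ultimately show ?thesis using uv(6) by metis
qed

lemma cokernel_iso_invariant:
  assumes q: "is_Z_cokernel C Z f q" and i: "i \<in> hom C (Cod C q) y" and j: "j \<in> hom C y (Cod C q)"
    and ji: "j \<cdot> i = Id C (Cod C q)" and ij: "i \<cdot> j = Id C y"
  shows "is_Z_cokernel C Z f (i \<cdot> q)"
proof -
  have fq: "f \<in> Arr C" "q \<in> Arr C" "Dom C q = Cod C f" "Z_trivial C Z (q \<cdot> f)"
    using q by (auto simp: is_Z_cokernel_def)
  have "Z_trivial C Z (i \<cdot> q \<cdot> f)"
    using trivial_comp_left[OF fq(4), of i] fq i by (simp add: cat_simps assoc)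
  moreover have "\<exists>!u. u \<in> hom C (Cod C (i \<cdot> q)) (Cod C x) \<and> u \<cdot> (i \<cdot> q) = x"
    if x: "x \<in> Arr C" "Dom C x = Cod C f" "Z_trivial C Z (x \<cdot> f)" for x
  proof -
    obtain u where u: "u \<in> hom C (Cod C q) (Cod C x)" "u \<cdot> q = x"
      using q x unfolding is_Z_cokernel_def by blast
    show ?thesis
    proof
      have "u \<cdot> j \<cdot> (i \<cdot> q) = u \<cdot> (j \<cdot> i) \<cdot> q"
        using u i j fq by (auto simp: cat_simps assoc)
      then show "u \<cdot> j \<in> hom C (Cod C (i \<cdot> q)) (Cod C x) \<and> u \<cdot> j \<cdot> (i \<cdot> q) = x"
        using u i j fq ji by (auto simp: cat_simps)
    next
      fix w assume w: "w \<in> hom C (Cod C (i \<cdot> q)) (Cod C x) \<and> w \<cdot> (i \<cdot> q) = x"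
      have "w \<cdot> i = u"
        by (rule cokernel_epi[OF q]) (use w u i fq in \<open>auto simp: cat_simps assoc\<close>)
      then have "w \<cdot> (i \<cdot> j) = u \<cdot> j" using w i j fq by (auto simp: cat_simps simp flip: assoc)
      then show "w = u \<cdot> j" using w i ij fq by (auto simp: cat_simps)
    qed
  qed
  ultimately show ?thesis
    using fq i unfolding is_Z_cokernel_def by (auto simp: cat_simps)
qed

lemma cokernel_unique:
  assumes q: "is_Z_cokernel C Z f q" and q': "is_Z_cokernel C Z f q'"
  obtains i j where "i \<in> hom C (Cod C q) (Cod C q')" "j \<in> hom C (Cod C q') (Cod C q)"
    "j \<cdot> i = Id C (Cod C q)" "i \<cdot> j = Id C (Cod C q')" "i \<cdot> q = q'"
proof -
  obtain i where i: "i \<in> hom C (Cod C q) (Cod C q')" "i \<cdot> q = q'"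
    using q q' unfolding is_Z_cokernel_def by blast
  obtain j where j: "j \<in> hom C (Cod C q') (Cod C q)" "j \<cdot> q' = q"
    using q q' unfolding is_Z_cokernel_def by blast
  have arr: "q \<in> Arr C" "q' \<in> Arr C" using q q' by (auto simp: is_Z_cokernel_def)
  have "j \<cdot> i = Id C (Cod C q)"
    by (rule cokernel_epi[OF q]) (use i j arr in \<open>auto simp: cat_simps assoc\<close>)
  moreover have "i \<cdot> j = Id C (Cod C q')"
    by (rule cokernel_epi[OF q']) (use i j arr in \<open>auto simp: cat_simps assoc\<close>)
  ultimately show ?thesis using that i j by blast
qed

text \<open>If \<open>q\<close> is a cokernel of \<open>f\<close>, then \<open>f\<close> factors through the kernel \<open>k\<close>; so an arrow
  that trivializes \<open>k\<close> trivializes \<open>f\<close> and factors through \<open>q\<close>.\<close>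

lemma normal_epi_cokernel_of_kernel:
  assumes "is_Z_normal_epi C Z q" and k: "is_Z_kernel C Z q k"
  shows "is_Z_cokernel C Z k q"
proof -
  obtain f where f: "is_Z_cokernel C Z f q" using assms(1) unfolding is_Z_normal_epi_def ..
  then have fq: "f \<in> Arr C" "q \<in> Arr C" "Dom C q = Cod C f" "Z_trivial C Z (q \<cdot> f)"
    by (auto simp: is_Z_cokernel_def)
  have kk: "k \<in> Arr C" "Cod C k = Dom C q" "Z_trivial C Z (q \<cdot> k)"
    using k by (auto simp: is_Z_kernel_def)
  obtain u where u: "u \<in> hom C (Dom C f) (Dom C k)" "k \<cdot> u = f"
    using k fq unfolding is_Z_kernel_def by metis
  have "\<exists>!v. v \<in> hom C (Cod C q) (Cod C x) \<and> v \<cdot> q = x"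
    if x: "x \<in> Arr C" "Dom C x = Cod C k" "Z_trivial C Z (x \<cdot> k)" for x
  proof -
    have "Z_trivial C Z (x \<cdot> f)"
      using trivial_comp_right[OF x(3), of u] u x kk by (auto simp: cat_simps assoc)
    then show ?thesis using f x kk fq unfolding is_Z_cokernel_def by simp
  qed
  then show ?thesis using kk fq unfolding is_Z_cokernel_def by auto
qed

end

lemma functorD:
  assumes "is_functor A B F"
  shows "category A" "category B"
    "x \<in> Obj A \<Longrightarrow> fobj F x \<in> Obj B"
    "f \<in> Arr A \<Longrightarrow> farr F f \<in> Arr B"
    "f \<in> Arr A \<Longrightarrow> Dom B (farr F f) = fobj F (Dom A f)"
    "f \<in> Arr A \<Longrightarrow> Cod B (farr F f) = fobj F (Cod A f)"
    "x \<in> Obj A \<Longrightarrow> farr F (Id A x) = Id B (fobj F x)"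
    "\<lbrakk>f \<in> Arr A; g \<in> Arr A; Cod A f = Dom A g\<rbrakk> \<Longrightarrow>
       farr F (g \<cdot>\<^bsub>A\<^esub> f) = farr F g \<cdot>\<^bsub>B\<^esub> farr F f"
  using assms unfolding is_functor_def by (auto simp: hom_def)

lemma functorI:
  assumes "category A" "category B"
    "\<And>x. x \<in> Obj A \<Longrightarrow> fobj F x \<in> Obj B"
    "\<And>f. f \<in> Arr A \<Longrightarrow> farr F f \<in> hom B (fobj F (Dom A f)) (fobj F (Cod A f))"
    "\<And>x. x \<in> Obj A \<Longrightarrow> farr F (Id A x) = Id B (fobj F x)"
    "\<And>f g. \<lbrakk>f \<in> Arr A; g \<in> Arr A; Cod A f = Dom A g\<rbrakk> \<Longrightarrow>
       farr F (g \<cdot>\<^bsub>A\<^esub> f) = farr F g \<cdot>\<^bsub>B\<^esub> farr F f"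
  shows "is_functor A B F"
  unfolding is_functor_def using assms by simp

lemma compose_functor_sel [simp]:
  "fobj (compose_functor G F) x = fobj G (fobj F x)"
  "farr (compose_functor G F) f = farr G (farr F f)"
  by (simp_all add: compose_functor_def)

lemma compose_is_functor:
  assumes F: "is_functor A B F" and G: "is_functor B C G"
  shows "is_functor A C (compose_functor G F)"
proof -
  interpret A: category A using functorD(1)[OF F] .
  interpret B: category B using functorD(2)[OF F] .
  interpret C: category C using functorD(2)[OF G] .
  show ?thesis
    by (rule functorI)
      (use F G in \<open>simp_all add: functorD[OF F] functorD[OF G] C.hom_iff
        A.category_axioms C.category_axioms\<close>)
qed

section \<open>Limits\<close>

lemma coneD:
  assumes "is_cone J C D x p"
  shows "x \<in> Obj C" "i \<in> Obj J \<Longrightarrow> p i \<in> Arr C" "i \<in> Obj J \<Longrightarrow> Dom C (p i) = x"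
    "i \<in> Obj J \<Longrightarrow> Cod C (p i) = fobj D i"
    "u \<in> Arr J \<Longrightarrow> farr D u \<cdot>\<^bsub>C\<^esub> p (Dom J u) = p (Cod J u)"
  using assms by (auto simp: is_cone_def hom_def)

lemma limit_factor:
  assumes "is_limit J C D l p" "is_cone J C D x q"
  shows "\<exists>!h. h \<in> hom C x l \<and> (\<forall>i \<in> Obj J. p i \<cdot>\<^bsub>C\<^esub> h = q i)"
  using assms by (simp add: is_limit_def)

lemma limit_cone: "is_limit J C D l p \<Longrightarrow> is_cone J C D l p"
  by (simp add: is_limit_def)

lemma limitI:
  assumes "is_cone J C D l p"
    "\<And>x q. is_cone J C D x q \<Longrightarrow> \<exists>!h. h \<in> hom C x l \<and> (\<forall>i \<in> Obj J. p i \<cdot>\<^bsub>C\<^esub> h = q i)"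
  shows "is_limit J C D l p"
  using assms by (simp add: is_limit_def)

lemma limit_jointly_monic:
  assumes C: "category C" and lim: "is_limit J C D l p" and J: "category J" and D: "is_functor J C D"
    and h: "h \<in> hom C x l" "h' \<in> hom C x l" "\<And>i. i \<in> Obj J \<Longrightarrow> p i \<cdot>\<^bsub>C\<^esub> h = p i \<cdot>\<^bsub>C\<^esub> h'"
  shows "h = h'"
proof -
  interpret category C by fact
  interpret J: category J by fact
  note p = coneD[OF limit_cone[OF lim]]
  have "is_cone J C D x (\<lambda>i. p i \<cdot>\<^bsub>C\<^esub> h)"
    unfolding is_cone_def using h(1) p functorD[OF D]
    by (auto simp: cat_simps J.cat_simps simp flip: assoc)
  from limit_factor[OF lim this] h show ?thesis by (metis (no_types, lifting))
qed

lemma limit_cong: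
  assumes J: "category J" and lim: "is_limit J C D l p"
    and p: "\<And>i. i \<in> Obj J \<Longrightarrow> p' i = p i"
  shows "is_limit J C D l p'"
proof -
  interpret J: category J by fact
  show ?thesis
    using lim p by (simp add: is_limit_def is_cone_def J.cat_simps)
qed

lemma limit_iso_invariant:
  assumes D: "is_functor J C D" and lim: "is_limit J C D l p"
    and i: "i \<in> hom C l' l" and j: "j \<in> hom C l l'"
    and ji: "j \<cdot>\<^bsub>C\<^esub> i = Id C l'" and ij: "i \<cdot>\<^bsub>C\<^esub> j = Id C l"
  shows "is_limit J C D l' (\<lambda>k. p k \<cdot>\<^bsub>C\<^esub> i)"
proof (rule limitI)
  interpret category C using functorD(2)[OF D] .
  interpret J: category J using functorD(1)[OF D] .
  note p = coneD[OF limit_cone[OF lim]]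
  have i': "i \<in> Arr C" "Dom C i = l'" "Cod C i = l" and j': "j \<in> Arr C" "Dom C j = l" "Cod C j = l'"
    using i j by (simp_all add: hom_iff)
  show "is_cone J C D l' (\<lambda>k. p k \<cdot>\<^bsub>C\<^esub> i)"
    unfolding is_cone_def using i' p functorD[OF D] dom_in_obj[OF i'(1)]
    by (auto simp: cat_simps J.cat_simps simp flip: assoc)
  fix x q assume q: "is_cone J C D x q"
  from limit_factor[OF lim q] obtain h where
    h: "h \<in> Arr C" "Dom C h = x" "Cod C h = l" "\<And>k. k \<in> Obj J \<Longrightarrow> p k \<cdot>\<^bsub>C\<^esub> h = q k"
    by (auto simp: hom_iff)
  show "\<exists>!h. h \<in> hom C x l' \<and> (\<forall>k \<in> Obj J. p k \<cdot>\<^bsub>C\<^esub> i \<cdot>\<^bsub>C\<^esub> h = q k)"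
  proof
    have "p k \<cdot>\<^bsub>C\<^esub> i \<cdot>\<^bsub>C\<^esub> (j \<cdot>\<^bsub>C\<^esub> h) = q k" if k: "k \<in> Obj J" for k
    proof -
      have "p k \<cdot>\<^bsub>C\<^esub> i \<cdot>\<^bsub>C\<^esub> (j \<cdot>\<^bsub>C\<^esub> h) = p k \<cdot>\<^bsub>C\<^esub> (i \<cdot>\<^bsub>C\<^esub> j) \<cdot>\<^bsub>C\<^esub> h"
        using p(1) p(2,3,4)[OF k] i' j' h(1-3) by (simp add: cat_simps assoc)
      then show ?thesis using p(2,3,4)[OF k] h k by (simp add: ij cat_simps)
    qed
    then show "j \<cdot>\<^bsub>C\<^esub> h \<in> hom C x l' \<and> (\<forall>k \<in> Obj J. p k \<cdot>\<^bsub>C\<^esub> i \<cdot>\<^bsub>C\<^esub> (j \<cdot>\<^bsub>C\<^esub> h) = q k)"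
      using j' h(1-3) by (simp add: cat_simps)
  next
    fix g assume g: "g \<in> hom C x l' \<and> (\<forall>k \<in> Obj J. p k \<cdot>\<^bsub>C\<^esub> i \<cdot>\<^bsub>C\<^esub> g = q k)"
    then have g': "g \<in> Arr C" "Dom C g = x" "Cod C g = l'" by (simp_all add: hom_iff)
    have "i \<cdot>\<^bsub>C\<^esub> g = h"
      by (rule limit_jointly_monic[OF category_axioms lim J.category_axioms D])
        (use g g' h i' p in \<open>simp_all add: cat_simps flip: assoc\<close>)
    then have "j \<cdot>\<^bsub>C\<^esub> i \<cdot>\<^bsub>C\<^esub> g = j \<cdot>\<^bsub>C\<^esub> h" using i' j' g' by (simp add: assoc)
    then show "g = j \<cdot>\<^bsub>C\<^esub> h" using g' ji by (simp add: cat_simps)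
  qed
qed

lemma limit_unique:
  assumes D: "is_functor J C D" and l: "is_limit J C D l p" and l': "is_limit J C D l' p'"
  obtains i j where "i \<in> hom C l' l" "j \<in> hom C l l'" "j \<cdot>\<^bsub>C\<^esub> i = Id C l'" "i \<cdot>\<^bsub>C\<^esub> j = Id C l"
    "\<forall>k \<in> Obj J. p k \<cdot>\<^bsub>C\<^esub> i = p' k"
proof -
  interpret category C using functorD(2)[OF D] .
  interpret J: category J using functorD(1)[OF D] .
  note p = coneD[OF limit_cone[OF l]] and p' = coneD[OF limit_cone[OF l']]
  obtain i where i: "i \<in> Arr C" "Dom C i = l'" "Cod C i = l" "\<And>k. k \<in> Obj J \<Longrightarrow> p k \<cdot>\<^bsub>C\<^esub> i = p' k"
    using limit_factor[OF l limit_cone[OF l']] by (auto simp: hom_iff)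
  obtain j where j: "j \<in> Arr C" "Dom C j = l" "Cod C j = l'" "\<And>k. k \<in> Obj J \<Longrightarrow> p' k \<cdot>\<^bsub>C\<^esub> j = p k"
    using limit_factor[OF l' limit_cone[OF l]] by (auto simp: hom_iff)
  have "j \<cdot>\<^bsub>C\<^esub> i = Id C l'"
    by (rule limit_jointly_monic[OF category_axioms l' J.category_axioms D, where x = l'])
      (use i j p p' in \<open>simp_all add: cat_simps flip: assoc\<close>)
  moreover have "i \<cdot>\<^bsub>C\<^esub> j = Id C l"
    by (rule limit_jointly_monic[OF category_axioms l J.category_axioms D, where x = l])
      (use i j p p' in \<open>simp_all add: cat_simps flip: assoc\<close>)
  ultimately show ?thesis using that[of i j] i j by (simp add: hom_iff)
qed

text \<open>The definition of finite limits quantifies over index categories built from natural numbers.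
  A finite index category over arbitrary types is transported there along injections on its
  objects and arrows. This makes diagram shapes with structured index types available below.\<close>

lemma finite_limits_of_any_type:
  fixes J :: "('i, 'j) category"
  assumes lim: "has_finite_limits C" and fin: "finite (Obj J)" "finite (Arr J)"
    and D: "is_functor J C D"
  obtains l p where "is_limit J C D l p"
proof -
  interpret C: category C using functorD(2)[OF D] .
  interpret J: category J using functorD(1)[OF D] .
  obtain \<phi> :: "'i \<Rightarrow> nat" where \<phi>: "inj_on \<phi> (Obj J)"
    using finite_imp_inj_to_nat_seg[OF fin(1)] by blast
  obtain \<psi> :: "'j \<Rightarrow> nat" where \<psi>: "inj_on \<psi> (Arr J)"
    using finite_imp_inj_to_nat_seg[OF fin(2)] by blast
  define \<phi>' where "\<phi>' = inv_into (Obj J) \<phi>"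
  define \<psi>' where "\<psi>' = inv_into (Arr J) \<psi>"
  have \<phi>' [simp]: "\<phi>' (\<phi> i) = i" if "i \<in> Obj J" for i
    using that \<phi> by (simp add: \<phi>'_def)
  have \<psi>' [simp]: "\<psi>' (\<psi> u) = u" if "u \<in> Arr J" for u
    using that \<psi> by (simp add: \<psi>'_def)
  define K where "K = \<lparr>Obj = \<phi> ` Obj J, Arr = \<psi> ` Arr J, Dom = (\<lambda>u. \<phi> (Dom J (\<psi>' u))),
    Cod = (\<lambda>u. \<phi> (Cod J (\<psi>' u))), Id = (\<lambda>i. \<psi> (Id J (\<phi>' i))),
    Comp = (\<lambda>v u. \<psi> (\<psi>' v \<cdot>\<^bsub>J\<^esub> \<psi>' u))\<rparr>"
  have \<phi>_eq: "\<phi> i = \<phi> j \<longleftrightarrow> i = j" if "i \<in> Obj J" "j \<in> Obj J" for i j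
    using that \<phi> by (meson inj_on_eq_iff)
  have K: "category K"
    by unfold_locales
      (auto simp: K_def hom_def J.cat_simps \<phi>_eq J.assoc)
  define E where "E = \<lparr>fobj = fobj D \<circ> \<phi>', farr = farr D \<circ> \<psi>'\<rparr>"
  have E: "is_functor K C E"
    by (rule functorI)
      (use K functorD[OF D] in \<open>auto simp: K_def E_def C.hom_iff J.cat_simps \<phi>_eq C.category_axioms\<close>)
  have "finite (Obj K)" "finite (Arr K)" using fin by (simp_all add: K_def)
  then obtain l p where lp: "is_limit K C E l p"
    using lim K E unfolding has_finite_limits_def by blast
  have "is_limit J C D l (p \<circ> \<phi>)"
  proof (rule limitI)
    show "is_cone J C D l (p \<circ> \<phi>)"
      using limit_cone[OF lp] by (auto simp: is_cone_def K_def E_def J.cat_simps)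
    fix x q assume "is_cone J C D x q"
    then have "is_cone K C E x (q \<circ> \<phi>')"
      by (auto simp: is_cone_def K_def E_def J.cat_simps)
    from limit_factor[OF lp this]
    show "\<exists>!h. h \<in> hom C x l \<and> (\<forall>i \<in> Obj J. (p \<circ> \<phi>) i \<cdot>\<^bsub>C\<^esub> h = q i)"
      by (simp add: K_def)
  qed
  then show ?thesis using that by blast
qed

section \<open>Pullbacks as limits\<close>

text \<open>The arrows are pairs of their source and target, the category being thin; \<open>None\<close> is the
  common target of the two legs.\<close>

definition cospan :: "(bool option, bool option \<times> bool option) category" where
  "cospan = \<lparr>Obj = UNIV, Arr = {(i, j). i = j \<or> j = None}, Dom = fst, Cod = snd,
     Id = (\<lambda>i. (i, i)), Comp = (\<lambda>(j, k) (i, j'). (i, k))\<rparr>"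

definition cospan_diagram ::
  "('o, 'a) category \<Rightarrow> 'a \<Rightarrow> 'a \<Rightarrow> (bool option, bool option \<times> bool option, 'o, 'a) functor_data"
  where
  "cospan_diagram C f g =
     (let ob = (\<lambda>i. case i of None \<Rightarrow> Cod C f | Some b \<Rightarrow> if b then Dom C f else Dom C g) in
      \<lparr>fobj = ob,
       farr = (\<lambda>(i, j). if i = j then Id C (ob i) else if i = Some True then f else g)\<rparr>)"

lemma cospan_category: "category cospan"
  by unfold_locales (auto simp: cospan_def hom_def)

lemma cospan_finite: "finite (Obj cospan)" "finite (Arr cospan)"
  by simp_all

lemma cospan_diagram_functor:
  assumes "category C" "f \<in> Arr C" "g \<in> Arr C" "Cod C f = Cod C g"
  shows "is_functor cospan C (cospan_diagram C f g)"
proof -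
  interpret category C by fact
  show ?thesis
    by (rule functorI)
      (use assms cospan_category in \<open>auto simp: cospan_def cospan_diagram_def Let_def cat_simps
        split: option.splits\<close>)
qed

lemma ball_cospan:
  "(\<forall>i \<in> Obj cospan. P i) \<longleftrightarrow> P None \<and> P (Some True) \<and> P (Some False)"
  by (simp add: cospan_def split_option_all all_bool_eq)

lemma cospan_limit_is_pullback:
  assumes F: "is_functor cospan C F" and lim: "is_limit cospan C F l p"
  shows "is_pullback C (farr F (Some True, None)) (farr F (Some False, None))
    (p (Some True)) (p (Some False))"
proof (rule pullbackI)
  interpret category C using functorD(2)[OF F] .
  let ?f = "farr F (Some True, None)" and ?g = "farr F (Some False, None)"
  have obj: "i \<in> Obj cospan" for i by (simp add: cospan_def)
  have arr: "(i, None) \<in> Arr cospan" "(i, i) \<in> Arr cospan" for i by (simp_all add: cospan_def)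
  note p = coneD[OF limit_cone[OF lim]]
  have F_arr: "farr F (i, None) \<in> Arr C" "Dom C (farr F (i, None)) = fobj F i"
      "Cod C (farr F (i, None)) = fobj F None" for i
    using functorD(4-6)[OF F arr(1)] by (simp_all add: cospan_def)
  have F_id: "farr F (i, i) = Id C (fobj F i)" for i
    using functorD(7)[OF F obj] by (simp add: cospan_def)
  have comm: "farr F (i, None) \<cdot>\<^bsub>C\<^esub> p i = p None" for i
    using p(5)[OF arr(1)] by (simp add: cospan_def)
  show "?f \<in> Arr C" "?g \<in> Arr C" "p (Some True) \<in> Arr C" "p (Some False) \<in> Arr C"
    "Cod C ?f = Cod C ?g" "Dom C (p (Some True)) = Dom C (p (Some False))"
    "Cod C (p (Some True)) = Dom C ?f" "Cod C (p (Some False)) = Dom C ?g"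
    "?f \<cdot>\<^bsub>C\<^esub> p (Some True) = ?g \<cdot>\<^bsub>C\<^esub> p (Some False)"
    using p F_arr comm by (simp_all add: obj)
  fix x u v
  assume u: "u \<in> hom C x (Dom C ?f)" and v: "v \<in> hom C x (Dom C ?g)" and uv: "?f \<cdot>\<^bsub>C\<^esub> u = ?g \<cdot>\<^bsub>C\<^esub> v"
  define q where "q = (\<lambda>i. case i of None \<Rightarrow> ?f \<cdot>\<^bsub>C\<^esub> u | Some b \<Rightarrow> if b then u else v)"
  have q: "is_cone cospan C F x q"
    unfolding is_cone_def
  proof (intro conjI ballI)
    show "x \<in> Obj C" using u by (auto simp: hom_iff dom_in_obj)
    show q_hom: "q i \<in> hom C x (fobj F i)" for i
      using u v F_arr by (simp add: q_def hom_iff comp_typing split: option.split)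
    fix w assume "w \<in> Arr cospan"
    then obtain i j where w: "w = (i, j)" "i = j \<or> j = None" by (auto simp: cospan_def)
    show "farr F w \<cdot>\<^bsub>C\<^esub> q (Dom cospan w) = q (Cod cospan w)"
    proof (cases "i = j")
      case True
      then show ?thesis using w q_hom[of i] by (simp add: cospan_def F_id hom_iff id_left)
    next
      case False
      then have "j = None" "i = Some True \<or> i = Some False" using w by (cases i; auto)+
      then show ?thesis using w uv by (auto simp: cospan_def q_def)
    qed
  qed
  have "(h \<in> hom C x l \<and> (\<forall>i \<in> Obj cospan. p i \<cdot>\<^bsub>C\<^esub> h = q i)) \<longleftrightarrow>
      (h \<in> hom C x (Dom C (p (Some False))) \<and> p (Some True) \<cdot>\<^bsub>C\<^esub> h = u \<and> p (Some False) \<cdot>\<^bsub>C\<^esub> h = v)" for h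
  proof -
    have "p None \<cdot>\<^bsub>C\<^esub> h = ?f \<cdot>\<^bsub>C\<^esub> u" if "p (Some True) \<cdot>\<^bsub>C\<^esub> h = u" "h \<in> hom C x l"
    proof -
      have "p None \<cdot>\<^bsub>C\<^esub> h = ?f \<cdot>\<^bsub>C\<^esub> p (Some True) \<cdot>\<^bsub>C\<^esub> h" by (simp add: comm)
      also have "\<dots> = ?f \<cdot>\<^bsub>C\<^esub> (p (Some True) \<cdot>\<^bsub>C\<^esub> h)"
        using that(2) F_arr p(2-4)[OF obj] by (simp add: hom_iff assoc)
      finally show ?thesis using that(1) by simp
    qed
    then show ?thesis
      using p(3)[OF obj, of "Some False"]
      by (auto simp: q_def ball_cospan)
  qed
  with limit_factor[OF lim q]
  show "\<exists>!h. h \<in> hom C x (Dom C (p (Some False))) \<and> p (Some True) \<cdot>\<^bsub>C\<^esub> h = u \<and> p (Some False) \<cdot>\<^bsub>C\<^esub> h = v"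
    by simp
qed

text \<open>Together with the preceding lemma this lets pullbacks be compared through the
  uniqueness of limits.\<close>

lemma pullback_is_cospan_limit:
  assumes C: "category C" and pb: "is_pullback C f g g' f'"
  shows "is_limit cospan C (cospan_diagram C f g) (Dom C f')
    (\<lambda>i. case i of None \<Rightarrow> f \<cdot>\<^bsub>C\<^esub> g' | Some b \<Rightarrow> if b then g' else f')" (is "is_limit _ _ ?F _ ?p")
proof (rule limitI)
  interpret category C by fact
  note P = pullbackD[OF pb]
  show "is_cone cospan C ?F (Dom C f') ?p"
    using P by (auto simp: is_cone_def cospan_diagram_def Let_def cospan_def cat_simps
      split: option.splits)
  fix x q assume q: "is_cone cospan C ?F x q"
  note qD = coneD[OF q]
  have obj: "i \<in> Obj cospan" for i by (simp add: cospan_def)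
  have arr: "(i, None) \<in> Arr cospan" for i by (simp add: cospan_def)
  have q': "q (Some True) \<in> hom C x (Dom C f)" "q (Some False) \<in> hom C x (Dom C g)"
    using qD(2-4)[OF obj] by (simp_all add: hom_iff cospan_diagram_def Let_def)
  have fq: "f \<cdot>\<^bsub>C\<^esub> q (Some True) = q None" "g \<cdot>\<^bsub>C\<^esub> q (Some False) = q None"
    using qD(5)[OF arr, of "Some True"] qD(5)[OF arr, of "Some False"]
    by (simp_all add: cospan_diagram_def Let_def cospan_def)
  have "(h \<in> hom C x (Dom C f') \<and> (\<forall>i \<in> Obj cospan. ?p i \<cdot>\<^bsub>C\<^esub> h = q i)) \<longleftrightarrow>
      (h \<in> hom C x (Dom C f') \<and> g' \<cdot>\<^bsub>C\<^esub> h = q (Some True) \<and> f' \<cdot>\<^bsub>C\<^esub> h = q (Some False))" for h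
  proof -
    have "f \<cdot>\<^bsub>C\<^esub> g' \<cdot>\<^bsub>C\<^esub> h = q None" if "g' \<cdot>\<^bsub>C\<^esub> h = q (Some True)" "h \<in> hom C x (Dom C f')"
      using that P(1-8) fq by (simp add: hom_iff assoc)
    then show ?thesis by (auto simp: ball_cospan)
  qed
  with pullback_factor[OF pb q'] fq
  show "\<exists>!h. h \<in> hom C x (Dom C f') \<and> (\<forall>i \<in> Obj cospan. ?p i \<cdot>\<^bsub>C\<^esub> h = q i)"
    by simp
qed

lemma pullback_exists:
  assumes C: "category C" "has_finite_limits C" and fg: "f \<in> Arr C" "g \<in> Arr C" "Cod C f = Cod C g"
  obtains g' f' where "is_pullback C f g g' f'"
proof -
  note F = cospan_diagram_functor[OF C(1) fg]
  obtain l p where "is_limit cospan C (cospan_diagram C f g) l p"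
    using finite_limits_of_any_type[OF C(2) cospan_finite F] .
  from cospan_limit_is_pullback[OF F this] show ?thesis
    using that by (simp add: cospan_diagram_def Let_def)
qed

text \<open>A given pullback is isomorphic to the preserved limit of the same cospan, its image is
  isomorphic to the image of that limit, and being a limit is invariant under isomorphism.\<close>

lemma preserves_pullbacks_if_preserves_some_limit:
  assumes U: "is_functor D C U" and pb: "is_pullback D f g g' f'"
    and lim: "\<And>F. is_functor cospan D F \<Longrightarrow> \<exists>l p. is_limit cospan D F l p \<and>
      is_limit cospan C (compose_functor U F) (fobj U l) (\<lambda>i. farr U (p i))"
  shows "is_pullback C (farr U f) (farr U g) (farr U g') (farr U f')"
proof -
  interpret C: category C using functorD(2)[OF U] .
  interpret D: category D using functorD(1)[OF U] .
  note P = pullbackD[OF pb] and UD = functorD[OF U]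
  let ?F = "cospan_diagram D f g"
  let ?q = "\<lambda>i. case i of None \<Rightarrow> f \<cdot>\<^bsub>D\<^esub> g' | Some b \<Rightarrow> if b then g' else f'"
  have F: "is_functor cospan D ?F"
    using cospan_diagram_functor[OF D.category_axioms] P by blast
  have UF: "is_functor cospan C (compose_functor U ?F)" using compose_is_functor[OF F U] .
  obtain l p where lp: "is_limit cospan D ?F l p"
    and Ulp: "is_limit cospan C (compose_functor U ?F) (fobj U l) (\<lambda>i. farr U (p i))"
    using lim[OF F] by blast
  obtain i j where ij: "i \<in> hom D (Dom D f') l" "j \<in> hom D l (Dom D f')"
      "j \<cdot>\<^bsub>D\<^esub> i = Id D (Dom D f')" "i \<cdot>\<^bsub>D\<^esub> j = Id D l"
    and pi: "\<forall>k \<in> Obj cospan. p k \<cdot>\<^bsub>D\<^esub> i = ?q k"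
    using limit_unique[OF F lp pullback_is_cospan_limit[OF D.category_axioms pb]] .
  have l: "l \<in> Obj D" "Dom D f' \<in> Obj D" using ij(1) D.cod_in_obj P by (auto simp: hom_def D.dom_in_obj)
  have Uij: "farr U i \<in> hom C (fobj U (Dom D f')) (fobj U l)" "farr U j \<in> hom C (fobj U l) (fobj U (Dom D f'))"
    "farr U j \<cdot>\<^bsub>C\<^esub> farr U i = Id C (fobj U (Dom D f'))" "farr U i \<cdot>\<^bsub>C\<^esub> farr U j = Id C (fobj U l)"
    using ij l UD(8)[of i j] UD(8)[of j i] UD(4-7) by (simp_all add: C.hom_iff D.hom_iff)
  have "is_limit cospan C (compose_functor U ?F) (fobj U (Dom D f')) (\<lambda>k. farr U (p k) \<cdot>\<^bsub>C\<^esub> farr U i)"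
    using limit_iso_invariant[OF UF Ulp Uij] .
  then have "is_limit cospan C (compose_functor U ?F) (fobj U (Dom D f')) (\<lambda>k. farr U (?q k))"
  proof (rule limit_cong[OF cospan_category])
    fix k assume k: "k \<in> Obj cospan"
    show "farr U (?q k) = farr U (p k) \<cdot>\<^bsub>C\<^esub> farr U i"
      using UD(8)[of i "p k"] coneD(2,3)[OF limit_cone[OF lp] k] ij(1) pi k by (simp add: D.hom_iff)
  qed
  from cospan_limit_is_pullback[OF UF this] show ?thesis
    by (simp add: cospan_diagram_def Let_def)
qed

section \<open>Transfer of prenormality along jointly reflecting functors\<close>

context category
begin

lemma prenormalD:
  assumes "prenormal C Z"
  shows "mono_coreflective C Z" "has_finite_limits C"
    "is_Z_kernel C Z f k \<Longrightarrow> \<exists>q. is_Z_cokernel C Z k q"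
    "\<lbrakk>is_Z_normal_epi C Z q; is_pullback C q g g' q'\<rbrakk> \<Longrightarrow> is_Z_normal_epi C Z q'"
  using assms unfolding prenormal_def by blast+

lemma kernel_exists:
  assumes "has_finite_limits C" "\<And>y. y \<in> Obj C \<Longrightarrow> \<exists>e. coreflection C Z y e" "f \<in> Arr C"
  obtains k where "is_Z_kernel C Z f k"
proof -
  obtain e where e: "coreflection C Z (Cod C f) e" using assms(2,3) cod_in_obj by blast
  obtain k k' where "is_pullback C f e k k'"
    using pullback_exists[OF category_axioms assms(1,3), of e] coreflectionD[OF e] by metis
  then show ?thesis using that kernel_iff_pullback_of_coreflection[OF e] by blast
qed

end

text \<open>The transfer principle. Lifting and reflection are required in the form in which they are easy
  to verify: the lifted arrow need only have the right domain and componentwise be a cokernel, and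
  reflection then shows that it is a cokernel in \<open>D\<close>. Lifting is asked of kernels, so that
  an arrow \<open>f\<close> of which \<open>k\<close> is a kernel is at hand in its construction.\<close>

lemma prenormal_by_joint_reflection:
  assumes C: "prenormal C Z" and D: "category D" and W: "W \<subseteq> Obj D"
    and iso: "\<And>x y. \<lbrakk>x \<in> W; isomorphic D x y\<rbrakk> \<Longrightarrow> y \<in> W"
    and lim: "has_finite_limits D"
    and U: "\<And>i. i \<in> I \<Longrightarrow> is_functor D C (U i)"
    and core: "\<And>y. y \<in> Obj D \<Longrightarrow> \<exists>e. coreflection D W y e \<and>
      (\<forall>i \<in> I. coreflection C Z (fobj (U i) y) (farr (U i) e))"
    and pb: "\<And>i f g g' f'. \<lbrakk>i \<in> I; is_pullback D f g g' f'\<rbrakk> \<Longrightarrow>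
      is_pullback C (farr (U i) f) (farr (U i) g) (farr (U i) g') (farr (U i) f')"
    and lift: "\<And>f k. \<lbrakk>is_Z_kernel D W f k; \<forall>i \<in> I. \<exists>q. is_Z_cokernel C Z (farr (U i) k) q\<rbrakk> \<Longrightarrow>
      \<exists>q \<in> Arr D. Dom D q = Cod D k \<and> (\<forall>i \<in> I. is_Z_cokernel C Z (farr (U i) k) (farr (U i) q))"
    and reflect: "\<And>k q. \<lbrakk>k \<in> Arr D; q \<in> Arr D; Dom D q = Cod D k;
      \<forall>i \<in> I. is_Z_cokernel C Z (farr (U i) k) (farr (U i) q)\<rbrakk> \<Longrightarrow> is_Z_cokernel D W k q"
  shows "prenormal D W"
proof -
  interpret C: category C using C unfolding prenormal_def by blast
  interpret D: category D by fact
  note CD = C.prenormalD[OF C]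
  have core': "\<exists>e. coreflection D W y e" if "y \<in> Obj D" for y using core[OF that] by blast
  have kernel: "is_Z_kernel C Z (farr (U i) f) (farr (U i) k)"
    if k: "is_Z_kernel D W f k" and i: "i \<in> I" for f k i
  proof -
    note UD = functorD[OF U[OF i]] and f = kernelD(1)[OF k]
    obtain e where e: "coreflection D W (Cod D f) e"
      and Ue: "coreflection C Z (fobj (U i) (Cod D f)) (farr (U i) e)"
      using core[OF D.cod_in_obj[OF f]] i by blast
    obtain k' where "is_pullback D f e k k'"
      using k D.kernel_iff_pullback_of_coreflection[OF e] by blast
    from pb[OF i this] Ue show ?thesis
      using C.kernel_iff_pullback_of_coreflection[of Z "farr (U i) f" "farr (U i) e"] UD(6)[OF f]
      by auto
  qed
  have lift': "\<exists>q. is_Z_cokernel D W k q \<and> (\<forall>i \<in> I. is_Z_cokernel C Z (farr (U i) k) (farr (U i) q))"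
    if k: "is_Z_kernel D W f k" for f k
    using lift[OF k] kernel[OF k] CD(3) reflect[OF kernelD(2)[OF k]] by metis
  have pointwise: "is_Z_cokernel C Z (farr (U i) k) (farr (U i) q)"
    if q: "is_Z_normal_epi D W q" and k: "is_Z_kernel D W q k" and i: "i \<in> I" for q k i
  proof -
    note UD = functorD[OF U[OF i]]
    obtain q0 where q0: "is_Z_cokernel D W k q0"
      and Uq0: "is_Z_cokernel C Z (farr (U i) k) (farr (U i) q0)"
      using lift'[OF k] i by blast
    have kq: "is_Z_cokernel D W k q" using D.normal_epi_cokernel_of_kernel[OF q k] .
    \<comment> \<open>Isomorphisms survive any functor, so it is enough to know the claim for \<open>q0\<close>.\<close>
    obtain a b where ab: "a \<in> hom D (Cod D q0) (Cod D q)" "b \<in> hom D (Cod D q) (Cod D q0)"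
      "b \<cdot>\<^bsub>D\<^esub> a = Id D (Cod D q0)" "a \<cdot>\<^bsub>D\<^esub> b = Id D (Cod D q)" "a \<cdot>\<^bsub>D\<^esub> q0 = q"
      using D.cokernel_unique[OF q0 kq] .
    have arr: "q0 \<in> Arr D" "q \<in> Arr D" using q0 kq by (auto dest: cokernelD)
    have "is_Z_cokernel C Z (farr (U i) k) (farr (U i) a \<cdot>\<^bsub>C\<^esub> farr (U i) q0)"
      by (rule C.cokernel_iso_invariant[OF Uq0, of _ "fobj (U i) (Cod D q)" "farr (U i) b"])
        (use ab arr UD(8)[of a b] UD(8)[of b a] UD(4-7) in
          \<open>simp_all add: C.hom_iff D.hom_iff D.cod_in_obj\<close>)
    then show ?thesis using ab(1,5) arr UD(8)[of q0 a] by (simp add: D.hom_iff)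
  qed
  have stable: "is_Z_normal_epi D W q'"
    if q: "is_Z_normal_epi D W q" and sq: "is_pullback D q g g' q'" for q g g' q'
  proof -
    note P = pullbackD[OF sq]
    obtain k where k: "is_Z_kernel D W q k" using D.kernel_exists[OF lim core' P(1)] .
    obtain k' where k': "is_Z_kernel D W q' k'" using D.kernel_exists[OF lim core' P(4)] .
    \<comment> \<open>Prenormality of \<open>C\<close> gives normality of the components of \<open>q'\<close>; their kernels are the
      components of \<open>k'\<close>.\<close>
    have "is_Z_cokernel C Z (farr (U i) k') (farr (U i) q')" if i: "i \<in> I" for i
    proof -
      have "is_Z_normal_epi C Z (farr (U i) q)"
        using pointwise[OF q k i] unfolding is_Z_normal_epi_def by blast
      then have "is_Z_normal_epi C Z (farr (U i) q')" using CD(4) pb[OF i sq] by blast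
      then show ?thesis using C.normal_epi_cokernel_of_kernel kernel[OF k' i] by blast
    qed
    then have "is_Z_cokernel D W k' q'" using reflect kernelD[OF k'] P(4) by metis
    then show ?thesis unfolding is_Z_normal_epi_def by blast
  qed
  show ?thesis
    unfolding prenormal_def
  proof (intro conjI allI impI)
    show "mono_coreflective D W" using W iso core' by (rule D.mono_coreflectiveI)
  qed (use D lim lift' stable in blast)+
qed

section \<open>Slice categories\<close>

definition slice_domain :: "('o, 'a) category \<Rightarrow> ('a, 'a \<times> 'a \<times> 'a, 'o, 'a) functor_data" where
  "slice_domain C = \<lparr>fobj = Dom C, farr = (\<lambda>(x, f, y). f)\<rparr>"

lemma slice_domain_sel [simp]:
  "fobj (slice_domain C) x = Dom C x" "farr (slice_domain C) (x, f, y) = f"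
  by (simp_all add: slice_domain_def)

context category
begin

lemma slice_sel [simp]:
  "x \<in> Obj (slice C c) \<longleftrightarrow> x \<in> Arr C \<and> Cod C x = c"
  "(x, f, y) \<in> Arr (slice C c) \<longleftrightarrow> x \<in> Arr C \<and> Cod C x = c \<and> y \<in> Arr C \<and> Cod C y = c \<and>
     f \<in> Arr C \<and> Dom C f = Dom C x \<and> Cod C f = Dom C y \<and> y \<cdot> f = x"
  "Dom (slice C c) (x, f, y) = x" "Cod (slice C c) (x, f, y) = y"
  "Id (slice C c) x = (x, Id C (Dom C x), x)"
  "(y', g, z) \<cdot>\<^bsub>slice C c\<^esub> (x, f, y) = (x, g \<cdot> f, z)"
  by (auto simp: slice_def hom_iff)

lemma slice_class_iff: "x \<in> slice_class C Z c \<longleftrightarrow> x \<in> Arr C \<and> Cod C x = c \<and> Dom C x \<in> Z"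
  by (auto simp: slice_class_def)

lemma slice_homE:
  assumes "u \<in> hom (slice C c) x y"
  obtains f where "u = (x, f, y)" "f \<in> Arr C" "Dom C f = Dom C x" "Cod C f = Dom C y" "y \<cdot> f = x"
    "x \<in> Arr C" "Cod C x = c" "y \<in> Arr C" "Cod C y = c"
proof (cases u)
  case (fields x' f y')
  have eq: "x' = x" "y' = y" using assms by (simp_all add: fields hom_def)
  have "(x, f, y) \<in> Arr (slice C c)" using assms unfolding fields eq hom_def by blast
  then show ?thesis using that[of f] fields eq by simp
qed

lemma slice_category:
  assumes "c \<in> Obj C"
  shows "category (slice C c)"
proof
  show "h \<cdot>\<^bsub>slice C c\<^esub> g \<cdot>\<^bsub>slice C c\<^esub> f = h \<cdot>\<^bsub>slice C c\<^esub> (g \<cdot>\<^bsub>slice C c\<^esub> f)"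
    if "f \<in> hom (slice C c) w x" "g \<in> hom (slice C c) x y" "h \<in> hom (slice C c) y z" for f g h w x y z
    using that by (cases f, cases g, cases h) (auto simp: hom_def assoc)
  show "g \<cdot>\<^bsub>slice C c\<^esub> f \<in> hom (slice C c) x z"
    if "f \<in> hom (slice C c) x y" "g \<in> hom (slice C c) y z" for f g x y z
    using that by (cases f, cases g) (auto simp: hom_def comp_typing simp flip: assoc)
qed (auto simp: hom_def id_typing id_left id_right dom_in_obj)

lemma slice_domain_functor:
  assumes c: "c \<in> Obj C"
  shows "is_functor (slice C c) C (slice_domain C)"
proof (rule functorI)
  fix f assume "f \<in> Arr (slice C c)"
  then show "farr (slice_domain C) f \<in> hom C (fobj (slice_domain C) (Dom (slice C c) f))
      (fobj (slice_domain C) (Cod (slice C c) f))"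
    by (cases f) (simp add: hom_iff)
next
  fix f g
  show "farr (slice_domain C) (g \<cdot>\<^bsub>slice C c\<^esub> f) = farr (slice_domain C) g \<cdot> farr (slice_domain C) f"
    by (cases f, cases g) simp
qed (use c in \<open>simp_all add: slice_category category_axioms dom_in_obj\<close>)

lemma slice_trivial_iff:
  "Z_trivial (slice C c) (slice_class C Z c) (x, f, y) \<longleftrightarrow>
     (x, f, y) \<in> Arr (slice C c) \<and> Z_trivial C Z f"
proof
  assume "Z_trivial (slice C c) (slice_class C Z c) (x, f, y)"
  then obtain z a b where z: "z \<in> slice_class C Z c"
    "a \<in> hom (slice C c) (Dom (slice C c) (x, f, y)) z"
    "b \<in> hom (slice C c) z (Cod (slice C c) (x, f, y))" "(x, f, y) = b \<cdot>\<^bsub>slice C c\<^esub> a"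
    and arr: "(x, f, y) \<in> Arr (slice C c)"
    unfolding Z_trivial_def by blast
  obtain a' where a: "a = (x, a', z)" "a' \<in> Arr C" "Cod C a' = Dom C z"
    using z(2) unfolding slice_sel by (rule slice_homE)
  obtain b' where b: "b = (z, b', y)" "b' \<in> Arr C" "Dom C b' = Dom C z"
    using z(3) unfolding slice_sel by (rule slice_homE)
  have "Dom C z \<in> Z" "f = b' \<cdot> a'" using z(1,4) a(1) b(1) by (simp_all add: slice_class_iff)
  with a b
  show "(x, f, y) \<in> Arr (slice C c) \<and> Z_trivial C Z f"
    using arr trivialI by simp
next
  assume "(x, f, y) \<in> Arr (slice C c) \<and> Z_trivial C Z f"
  then have arr: "(x, f, y) \<in> Arr (slice C c)" and triv: "Z_trivial C Z f" by auto
  obtain a b where ab: "a \<in> Arr C" "b \<in> Arr C" "Cod C a = Dom C b" "Dom C b \<in> Z"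
    "Dom C a = Dom C f" "Cod C b = Cod C f" "b \<cdot> a = f"
    using triv by (rule trivialE)
  have "y \<cdot> b \<in> slice_class C Z c" "(x, a, y \<cdot> b) \<in> hom (slice C c) x (y \<cdot> b)"
    "(y \<cdot> b, b, y) \<in> hom (slice C c) (y \<cdot> b) y"
    using ab arr by (simp_all add: slice_class_iff hom_def comp_typing assoc)
  then show "Z_trivial (slice C c) (slice_class C Z c) (x, f, y)"
    unfolding Z_trivial_def using arr ab(7) by force
qed

text \<open>A factorization \<open>g\<close> through \<open>e\<close> of an arrow \<open>f\<close> over \<open>c\<close> is itself over \<open>c\<close>, because
  \<open>(y \<cdot> e) \<cdot> g = y \<cdot> f\<close>.\<close>

lemma slice_coreflection:
  assumes y: "y \<in> Obj (slice C c)" and e: "coreflection C Z (Dom C y) e"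
  shows "coreflection (slice C c) (slice_class C Z c) y (y \<cdot> e, e, y)"
proof -
  note eD = coreflectionD[OF e]
  let ?E = "(y \<cdot> e, e, y)"
  have arr: "?E \<in> Arr (slice C c)" "Dom C (y \<cdot> e) = Dom C e" using y eD by (simp_all add: comp_typing)
  have "is_mono (slice C c) ?E"
    unfolding is_mono_def
  proof (intro conjI arr allI ballI impI)
    fix x f g
    assume fg: "f \<in> hom (slice C c) x (Dom (slice C c) ?E)" "g \<in> hom (slice C c) x (Dom (slice C c) ?E)"
      "?E \<cdot>\<^bsub>slice C c\<^esub> f = ?E \<cdot>\<^bsub>slice C c\<^esub> g"
    obtain f' where f': "f = (x, f', y \<cdot> e)" "f' \<in> Arr C" "Dom C f' = Dom C x" "Cod C f' = Dom C e"
      using fg(1) arr(2) by (auto elim: slice_homE)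
    obtain g' where g': "g = (x, g', y \<cdot> e)" "g' \<in> Arr C" "Dom C g' = Dom C x" "Cod C g' = Dom C e"
      using fg(2) arr(2) by (auto elim: slice_homE)
    have "f' = g'"
      by (rule mono_cancel[OF eD(4)]) (use fg(3) f' g' in simp_all)
    then show "f = g" using f' g' by simp
  qed
  moreover have "\<exists>g \<in> hom (slice C c) (Dom (slice C c) f) (Dom (slice C c) ?E). ?E \<cdot>\<^bsub>slice C c\<^esub> g = f"
    if f: "f \<in> Arr (slice C c)" "Dom (slice C c) f \<in> slice_class C Z c" "Cod (slice C c) f = y" for f
  proof -
    obtain x f' where [simp]: "f = (x, f', y)" using f(3) by (cases f) simp
    have f': "f' \<in> Arr C" "Dom C f' = Dom C x" "Dom C x \<in> Z" "Cod C f' = Dom C y" "y \<cdot> f' = x" "x \<in> Arr C" "Cod C x = c"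
      using f by (simp_all add: slice_class_iff)
    obtain g where g: "g \<in> Arr C" "Dom C g = Dom C x" "Cod C g = Dom C e" "e \<cdot> g = f'"
      using coreflection_factor[OF e f'(1)] f' by (auto simp: hom_iff)
    have "(x, g, y \<cdot> e) \<in> hom (slice C c) x (y \<cdot> e)"
      using g f' y eD by (simp add: hom_def comp_typing assoc)
    then show ?thesis using g by (intro bexI[of _ "(x, g, y \<cdot> e)"]) simp_all
  qed
  ultimately show ?thesis
    using y eD arr unfolding coreflection_def by (simp add: slice_class_iff)
qed

text \<open>A test object \<open>t\<close> of the square in \<open>C\<close> becomes one over \<open>c\<close> through \<open>x \<cdot> u\<close>, which equals
  \<open>y \<cdot> v\<close> because both factor through \<open>z\<close>.\<close>

lemma slice_domain_preserves_pullbacks: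
  assumes c: "c \<in> Obj C" and pb: "is_pullback (slice C c) f g g' f'"
  shows "is_pullback C (farr (slice_domain C) f) (farr (slice_domain C) g)
    (farr (slice_domain C) g') (farr (slice_domain C) f')"
proof -
  note P = pullbackD[OF pb]
  obtain w x y z f0 g0 g0' f0' where [simp]: "f = (x, f0, z)" "g = (y, g0, z)"
    "g' = (w, g0', x)" "f' = (w, f0', y)"
    using P(5-8) by (cases f, cases g, cases g', cases f') simp
  have arr: "x \<in> Arr C" "y \<in> Arr C" "z \<in> Arr C" "w \<in> Arr C" "Cod C x = c" "Cod C y = c"
      "Cod C z = c" "Cod C w = c" "z \<cdot> f0 = x" "z \<cdot> g0 = y" "x \<cdot> g0' = w" "y \<cdot> f0' = w"
    and ty: "f0 \<in> Arr C" "g0 \<in> Arr C" "g0' \<in> Arr C" "f0' \<in> Arr C" "Dom C f0 = Dom C x"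
      "Cod C f0 = Dom C z" "Dom C g0 = Dom C y" "Cod C g0 = Dom C z" "Dom C g0' = Dom C w"
      "Cod C g0' = Dom C x" "Dom C f0' = Dom C w" "Cod C f0' = Dom C y"
    and comm: "f0 \<cdot> g0' = g0 \<cdot> f0'"
    using P by simp_all
  have "is_pullback C f0 g0 g0' f0'"
  proof (rule pullbackI)
    fix t u v
    assume u: "u \<in> hom C t (Dom C f0)" and v: "v \<in> hom C t (Dom C g0)" and uv: "f0 \<cdot> u = g0 \<cdot> v"
    have ty': "u \<in> Arr C" "Dom C u = t" "Cod C u = Dom C x" "v \<in> Arr C" "Dom C v = t" "Cod C v = Dom C y"
      using u v ty by (simp_all add: hom_iff)
    let ?t = "x \<cdot> u"
    have "?t = z \<cdot> f0 \<cdot> u" by (simp add: arr)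
    also have "\<dots> = z \<cdot> (g0 \<cdot> v)" using arr(3) ty ty' uv by (simp add: assoc)
    also have "\<dots> = y \<cdot> v" using arr(3,10) ty ty' by (simp flip: assoc)
    finally have t: "y \<cdot> v = ?t" by simp
    have t': "?t \<in> Arr C" "Dom C ?t = t" "Cod C ?t = c" using arr ty' by (simp_all add: comp_typing)
    have "(?t, u, x) \<in> hom (slice C c) ?t (Dom (slice C c) f)"
      "(?t, v, y) \<in> hom (slice C c) ?t (Dom (slice C c) g)"
      "f \<cdot>\<^bsub>slice C c\<^esub> (?t, u, x) = g \<cdot>\<^bsub>slice C c\<^esub> (?t, v, y)"
      using arr(1-8) ty' t t' uv by (simp_all add: hom_def)
    from pullback_factor[OF pb this]
    have "\<exists>!h. h \<in> hom (slice C c) ?t w \<and> g' \<cdot>\<^bsub>slice C c\<^esub> h = (?t, u, x) \<and>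
        f' \<cdot>\<^bsub>slice C c\<^esub> h = (?t, v, y)"
      by (simp only: \<open>f' = (w, f0', y)\<close> slice_sel)
    then obtain h where h: "h \<in> hom (slice C c) ?t w \<and> g' \<cdot>\<^bsub>slice C c\<^esub> h = (?t, u, x) \<and>
        f' \<cdot>\<^bsub>slice C c\<^esub> h = (?t, v, y)"
      and uniq: "\<forall>h'. h' \<in> hom (slice C c) ?t w \<and> g' \<cdot>\<^bsub>slice C c\<^esub> h' = (?t, u, x) \<and>
        f' \<cdot>\<^bsub>slice C c\<^esub> h' = (?t, v, y) \<longrightarrow> h' = h"
      by (rule ex1E)
    obtain h0 where h0: "h = (?t, h0, w)" using h by (elim conjE slice_homE)
    have "h0 \<in> hom C t (Dom C f0')" "g0' \<cdot> h0 = u" "f0' \<cdot> h0 = v"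
      using h h0 t' ty by (simp_all add: hom_def)
    moreover have "k = h0" if k: "k \<in> hom C t (Dom C f0')" "g0' \<cdot> k = u" "f0' \<cdot> k = v" for k
    proof -
      have k': "k \<in> Arr C" "Dom C k = t" "Cod C k = Dom C w" using k(1) ty by (simp_all add: hom_iff)
      have "w \<cdot> k = x \<cdot> g0' \<cdot> k" by (simp add: arr)
      also have "\<dots> = ?t" using k(2) k' arr(1) ty by (simp add: assoc)
      finally have "(?t, k, w) \<in> hom (slice C c) ?t w"
        using k' t' arr by (simp add: hom_def)
      with uniq[rule_format, of "(?t, k, w)"] show ?thesis using k h0 by simp
    qed
    ultimately show "\<exists>!h. h \<in> hom C t (Dom C f0') \<and> g0' \<cdot> h = u \<and> f0' \<cdot> h = v" by blast
  qed (use ty comm in simp_all)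
  then show ?thesis by simp
qed

text \<open>The factorization obtained in \<open>C\<close> is automatically an arrow over \<open>c\<close>, because \<open>q\<close> is epic.\<close>

lemma slice_cokernelI:
  assumes q: "is_Z_cokernel C Z k q" and k: "(w, k, x) \<in> Arr (slice C c)" and arr: "(x, q, y) \<in> Arr (slice C c)"
  shows "is_Z_cokernel (slice C c) (slice_class C Z c) (w, k, x) (x, q, y)"
proof (rule cokernelI)
  note qD = cokernelD[OF q]
  let ?k = "(w, k, x)" and ?q = "(x, q, y)"
  show "?k \<in> Arr (slice C c)" "?q \<in> Arr (slice C c)" "Dom (slice C c) ?q = Cod (slice C c) ?k"
    using k arr by simp_all
  have "y \<cdot> q \<cdot> k = y \<cdot> (q \<cdot> k)" by (rule assoc) (use k arr in simp_all)
  then have "y \<cdot> (q \<cdot> k) = w" using k arr by simp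
  then show "Z_trivial (slice C c) (slice_class C Z c) (?q \<cdot>\<^bsub>slice C c\<^esub> ?k)"
    using qD k arr by (simp add: slice_trivial_iff comp_typing)
  fix g
  assume g: "g \<in> Arr (slice C c)" "Dom (slice C c) g = Cod (slice C c) ?k"
    and triv: "Z_trivial (slice C c) (slice_class C Z c) (g \<cdot>\<^bsub>slice C c\<^esub> ?k)"
  obtain v g0 where [simp]: "g = (x, g0, v)" using g(2) by (cases g) simp
  have g0: "g0 \<in> Arr C" "Dom C g0 = Dom C x" "Cod C g0 = Dom C v" "v \<cdot> g0 = x" "v \<in> Arr C" "Cod C v = c"
    using g(1) by simp_all
  have "\<exists>!u. u \<in> hom C (Cod C q) (Cod C g0) \<and> u \<cdot> q = g0"
    by (rule cokernel_factor[OF q g0(1)]) (use g0(2) k triv in \<open>simp_all add: slice_trivial_iff\<close>)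
  then obtain u where u: "u \<in> Arr C" "Dom C u = Dom C y" "Cod C u = Dom C v" "u \<cdot> q = g0"
    using arr g0 by (auto simp: hom_iff)
  have "v \<cdot> u \<cdot> q = y \<cdot> q"
    using u g0(4,5) arr qD by (simp add: assoc)
  then have vu: "v \<cdot> u = y"
    by (intro cokernel_epi[OF q, of "v \<cdot> u" y]) (use u g0 arr in \<open>simp_all add: comp_typing\<close>)
  show "\<exists>!u. u \<in> hom (slice C c) (Cod (slice C c) ?q) (Cod (slice C c) g) \<and> u \<cdot>\<^bsub>slice C c\<^esub> ?q = g"
  proof
    show "(y, u, v) \<in> hom (slice C c) (Cod (slice C c) ?q) (Cod (slice C c) g) \<and>
        (y, u, v) \<cdot>\<^bsub>slice C c\<^esub> ?q = g"
      using u vu g0 arr by (simp add: hom_def)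
    fix u' assume u': "u' \<in> hom (slice C c) (Cod (slice C c) ?q) (Cod (slice C c) g) \<and> u' \<cdot>\<^bsub>slice C c\<^esub> ?q = g"
    then obtain u0 where u0: "u' = (y, u0, v)" using slice_homE[of u' c y v] by auto
    have "u0 = u"
      by (rule cokernel_epi[OF q]) (use u' u0 u arr in \<open>simp_all add: hom_def\<close>)
    then show "u' = (y, u, v)" by (simp add: u0)
  qed
qed

text \<open>The missing structure map of the codomain of \<open>q\<close> comes from \<open>f\<close>: as \<open>f \<cdot> k\<close> is trivial,
  \<open>f = t \<cdot> q\<close> for a unique \<open>t\<close>, and \<open>y \<cdot> t\<close> is a map to \<open>c\<close> that restricts to \<open>x\<close> along \<open>q\<close>.
  For an arrow \<open>k\<close> without such an \<open>f\<close>, the map \<open>x\<close> need not factor through \<open>q\<close>.\<close>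

lemma slice_cokernel_lift:
  assumes k: "is_Z_kernel (slice C c) (slice_class C Z c) f k"
    and q: "is_Z_cokernel C Z (farr (slice_domain C) k) q"
  shows "\<exists>q \<in> Arr (slice C c). Dom (slice C c) q = Cod (slice C c) k \<and>
    is_Z_cokernel C Z (farr (slice_domain C) k) (farr (slice_domain C) q)"
proof -
  note kD = kernelD[OF k] and qD = cokernelD[OF q]
  obtain w x y k0 f0 where [simp]: "f = (x, f0, y)" "k = (w, k0, x)"
    using kD(3) by (cases f, cases k) simp
  have arr: "f0 \<in> Arr C" "Dom C f0 = Dom C x" "Cod C f0 = Dom C y" "y \<cdot> f0 = x" "y \<in> Arr C" "Cod C y = c"
    "x \<in> Arr C" "Cod C x = c" "Cod C k0 = Dom C x"
    using kD(1,2) by simp_all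
  have "\<exists>!t. t \<in> hom C (Cod C q) (Cod C f0) \<and> t \<cdot> q = f0"
    by (rule cokernel_factor[OF q arr(1)]) (use arr kD(4) in \<open>simp_all add: slice_trivial_iff\<close>)
  then obtain t where t: "t \<in> Arr C" "Dom C t = Cod C q" "Cod C t = Dom C y" "t \<cdot> q = f0"
    using arr by (auto simp: hom_iff)
  have "(x, q, y \<cdot> t) \<in> Arr (slice C c)"
    using t arr qD by (simp add: comp_typing assoc)
  then show ?thesis using q by (intro bexI[of _ "(x, q, y \<cdot> t)"]) simp_all
qed

end

text \<open>\<open>J\<close> with a terminal object \<open>None\<close> freely adjoined. \<open>Inr (Some i)\<close> is the arrow from \<open>i\<close> to it and
  \<open>Inr None\<close> its identity. The composite of \<open>Inr\<close> after \<open>Inl\<close> therefore depends only on the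
  domain of the latter; \<open>Inl\<close> after \<open>Inr\<close> never is a composable pair.\<close>

definition right_cone :: "('i, 'j) category \<Rightarrow> ('i option, 'j + 'i option) category" where
  "right_cone J = \<lparr>Obj = insert None (Some ` Obj J),
     Arr = Inl ` Arr J \<union> Inr ` insert None (Some ` Obj J),
     Dom = case_sum (\<lambda>u. Some (Dom J u)) (\<lambda>i. i),
     Cod = case_sum (\<lambda>u. Some (Cod J u)) (\<lambda>i. None),
     Id = case_option (Inr None) (\<lambda>i. Inl (Id J i)),
     Comp = (\<lambda>v u. case v of
         Inl v' \<Rightarrow> (case u of Inl u' \<Rightarrow> Inl (v' \<cdot>\<^bsub>J\<^esub> u') | Inr i \<Rightarrow> Inr i)
       | Inr _ \<Rightarrow> Inr (case u of Inl u' \<Rightarrow> Some (Dom J u') | Inr i \<Rightarrow> i))\<rparr>"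

text \<open>A diagram in \<open>C/c\<close> is a diagram in \<open>C\<close> with a cocone to \<open>c\<close>, that is, a diagram of this
  extended shape.\<close>

definition right_cone_diagram ::
  "('o, 'a) category \<Rightarrow> 'o \<Rightarrow> ('i, 'j, 'a, 'a \<times> 'a \<times> 'a) functor_data \<Rightarrow>
   ('i option, 'j + 'i option, 'o, 'a) functor_data" where
  "right_cone_diagram C c D =
     \<lparr>fobj = case_option c (\<lambda>i. Dom C (fobj D i)),
      farr = case_sum (\<lambda>u. fst (snd (farr D u))) (case_option (Id C c) (fobj D))\<rparr>"

lemma right_cone_category:
  assumes "category J"
  shows "category (right_cone J)"
proof -
  interpret J: category J by fact
  show ?thesis
    by unfold_locales (auto simp: right_cone_def hom_def J.cat_simps J.assoc)
qed

context category
begin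

lemma right_cone_diagram_functor:
  assumes c: "c \<in> Obj C" and D: "is_functor J (slice C c) D"
  shows "is_functor (right_cone J) C (right_cone_diagram C c D)"
proof -
  interpret J: category J using functorD(1)[OF D] .
  have D_obj: "fobj D i \<in> Arr C" "Cod C (fobj D i) = c" if "i \<in> Obj J" for i
    using functorD(3)[OF D that] by simp_all
  have D_arr: "\<exists>f. farr D u = (fobj D (Dom J u), f, fobj D (Cod J u)) \<and>
      (fobj D (Dom J u), f, fobj D (Cod J u)) \<in> Arr (slice C c)" if "u \<in> Arr J" for u
    using functorD(4-6)[OF D that] by (cases "farr D u") auto
  show ?thesis
  proof (rule functorI)
    fix u assume "u \<in> Arr (right_cone J)"
    then show "farr (right_cone_diagram C c D) u \<in>
        hom C (fobj (right_cone_diagram C c D) (Dom (right_cone J) u))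
          (fobj (right_cone_diagram C c D) (Cod (right_cone J) u))"
      using D_arr D_obj c
      by (fastforce simp: right_cone_def right_cone_diagram_def cat_simps)
  next
    fix u v
    assume uv: "u \<in> Arr (right_cone J)" "v \<in> Arr (right_cone J)" "Cod (right_cone J) u = Dom (right_cone J) v"
    show "farr (right_cone_diagram C c D) (v \<cdot>\<^bsub>right_cone J\<^esub> u) =
        farr (right_cone_diagram C c D) v \<cdot> farr (right_cone_diagram C c D) u"
    proof (cases u)
      case (Inl u')
      note u = this
      then have u': "u' \<in> Arr J" using uv by (auto simp: right_cone_def)
      show ?thesis
      proof (cases v)
        case (Inl v')
        then have v': "v' \<in> Arr J" "Cod J u' = Dom J v'" using uv u by (auto simp: right_cone_def)
        show ?thesis
          using functorD(8)[OF D u' v'] D_arr[OF u'] D_arr[OF v'(1)] u Inl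
          by (auto simp: right_cone_def right_cone_diagram_def)
      next
        case (Inr i)
        then show ?thesis
          using uv u D_arr[OF u'] by (auto simp: right_cone_def right_cone_diagram_def)
      qed
    next
      case (Inr i)
      then show ?thesis
        using uv D_obj c by (cases v; cases i) (auto simp: right_cone_def right_cone_diagram_def cat_simps)
    qed
  next
    fix i assume "i \<in> Obj (right_cone J)"
    then show "farr (right_cone_diagram C c D) (Id (right_cone J) i) = Id C (fobj (right_cone_diagram C c D) i)"
      using functorD(7)[OF D] c by (auto simp: right_cone_def right_cone_diagram_def)
  qed (use right_cone_category[OF J.category_axioms] category_axioms D_obj c in
      \<open>auto simp: right_cone_def right_cone_diagram_def dom_in_obj\<close>)
qed

text \<open>The component of the limit cone at the adjoined vertex is the structure map to \<open>c\<close>. For empty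
  \<open>J\<close> this gives the identity of \<open>c\<close> as terminal object of the slice, up to isomorphism.\<close>

lemma right_cone_limit_is_slice_limit:
  assumes c: "c \<in> Obj C" and D: "is_functor J (slice C c) D"
    and lim: "is_limit (right_cone J) C (right_cone_diagram C c D) l p"
  shows "is_limit J (slice C c) D (p None) (\<lambda>i. (p None, p (Some i), fobj D i))"
proof (rule limitI)
  interpret J: category J using functorD(1)[OF D] .
  let ?F = "right_cone_diagram C c D"
  have obj [simp]: "None \<in> Obj (right_cone J)" "Some i \<in> Obj (right_cone J) \<longleftrightarrow> i \<in> Obj J" for i
    by (auto simp: right_cone_def)
  have F [simp]: "fobj ?F None = c" "fobj ?F (Some i) = Dom C (fobj D i)" for i
    by (simp_all add: right_cone_diagram_def)
  have D_obj: "fobj D i \<in> Arr C" "Cod C (fobj D i) = c" if "i \<in> Obj J" for i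
    using functorD(3)[OF D that] by simp_all
  have D_arr: "\<exists>f. farr D u = (fobj D (Dom J u), f, fobj D (Cod J u)) \<and>
      (fobj D (Dom J u), f, fobj D (Cod J u)) \<in> Arr (slice C c)" if "u \<in> Arr J" for u
    using functorD(4-6)[OF D that] by (cases "farr D u") auto
  note p = coneD[OF limit_cone[OF lim]]
  have pN: "p None \<in> Arr C" "Dom C (p None) = l" "Cod C (p None) = c"
    using p(2-4)[OF obj(1)] by simp_all
  have pS: "p (Some i) \<in> Arr C" "Dom C (p (Some i)) = l" "Cod C (p (Some i)) = Dom C (fobj D i)"
    "fobj D i \<cdot> p (Some i) = p None" if "i \<in> Obj J" for i
    using p(2-4)[of "Some i"] p(5)[of "Inr (Some i)"] that
    by (auto simp: right_cone_def right_cone_diagram_def)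
  show "is_cone J (slice C c) D (p None) (\<lambda>i. (p None, p (Some i), fobj D i))"
    unfolding is_cone_def
  proof (intro conjI ballI)
    fix u assume u: "u \<in> Arr J"
    then have "Inl u \<in> Arr (right_cone J)" by (simp add: right_cone_def)
    from p(5)[OF this]
    show "farr D u \<cdot>\<^bsub>slice C c\<^esub> (p None, p (Some (Dom J u)), fobj D (Dom J u)) =
        (p None, p (Some (Cod J u)), fobj D (Cod J u))"
      using D_arr[OF u] by (auto simp: right_cone_def right_cone_diagram_def)
  qed (use pN pS D_obj in \<open>auto simp: hom_def\<close>)
  fix x q assume q: "is_cone J (slice C c) D x q"
  note qD = coneD[OF q]
  have x: "x \<in> Arr C" "Cod C x = c" using qD(1) by simp_all
  define m where "m i = fst (snd (q i))" for i
  have m: "q i = (x, m i, fobj D i)" "m i \<in> Arr C" "Dom C (m i) = Dom C x"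
    "Cod C (m i) = Dom C (fobj D i)" "fobj D i \<cdot> m i = x" if "i \<in> Obj J" for i
    using qD(2-4)[OF that] by (cases "q i"; auto simp: m_def)+
  have "is_cone (right_cone J) C ?F (Dom C x) (case_option x m)"
    unfolding is_cone_def
  proof (intro conjI ballI)
    show "Dom C x \<in> Obj C" using x by (simp add: dom_in_obj)
    fix i assume "i \<in> Obj (right_cone J)"
    then show "case_option x m i \<in> hom C (Dom C x) (fobj ?F i)"
      using x m by (cases i) (simp_all add: hom_iff)
  next
    fix u assume u: "u \<in> Arr (right_cone J)"
    show "farr ?F u \<cdot> case_option x m (Dom (right_cone J) u) = case_option x m (Cod (right_cone J) u)"
    proof (cases u)
      case (Inl u')
      then have u': "u' \<in> Arr J" using u by (auto simp: right_cone_def)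
      show ?thesis
        using qD(5)[OF u'] D_arr[OF u'] m[OF J.dom_in_obj[OF u']] m[OF J.cod_in_obj[OF u']] Inl
        by (auto simp: right_cone_def right_cone_diagram_def)
    next
      case (Inr i)
      then show ?thesis
        using u x m by (cases i) (auto simp: right_cone_def right_cone_diagram_def id_left)
    qed
  qed
  from limit_factor[OF lim this]
  have ex: "\<exists>!h. h \<in> hom C (Dom C x) l \<and> p None \<cdot> h = x \<and> (\<forall>i \<in> Obj J. p (Some i) \<cdot> h = m i)"
    by (simp add: right_cone_def)
  then obtain h where h: "h \<in> hom C (Dom C x) l" "p None \<cdot> h = x" "\<forall>i \<in> Obj J. p (Some i) \<cdot> h = m i"
    by blast
  show "\<exists>!h. h \<in> hom (slice C c) x (p None) \<and>
      (\<forall>i \<in> Obj J. (p None, p (Some i), fobj D i) \<cdot>\<^bsub>slice C c\<^esub> h = q i)"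
  proof
    show "(x, h, p None) \<in> hom (slice C c) x (p None) \<and>
      (\<forall>i \<in> Obj J. (p None, p (Some i), fobj D i) \<cdot>\<^bsub>slice C c\<^esub> (x, h, p None) = q i)"
      using h x pN m by (simp add: hom_def)
    fix g assume g: "g \<in> hom (slice C c) x (p None) \<and>
      (\<forall>i \<in> Obj J. (p None, p (Some i), fobj D i) \<cdot>\<^bsub>slice C c\<^esub> g = q i)"
    then obtain g0 where g0: "g = (x, g0, p None)" by (elim conjE slice_homE)
    have "g0 \<in> hom C (Dom C x) l \<and> p None \<cdot> g0 = x \<and> (\<forall>i \<in> Obj J. p (Some i) \<cdot> g0 = m i)"
      using g g0 pN m by (simp add: hom_def)
    then show "g = (x, h, p None)" using ex h g0 by blast
  qed
qed

lemma slice_has_finite_limits: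
  assumes lim: "has_finite_limits C" and c: "c \<in> Obj C"
  shows "has_finite_limits (slice C c)"
  unfolding has_finite_limits_def
proof (intro allI impI, elim conjE)
  fix J :: "(nat, nat) category" and D
  assume J: "finite (Obj J)" "finite (Arr J)" and D: "is_functor J (slice C c) D"
  have "finite (Obj (right_cone J))" "finite (Arr (right_cone J))"
    using J by (simp_all add: right_cone_def)
  then obtain l p where "is_limit (right_cone J) C (right_cone_diagram C c D) l p"
    using finite_limits_of_any_type[OF lim] right_cone_diagram_functor[OF c D] by metis
  then show "\<exists>l p. is_limit J (slice C c) D l p"
    using right_cone_limit_is_slice_limit[OF c D] by blast
qed

lemma slice_class_iso_closed:
  assumes iso: "\<And>x y. \<lbrakk>x \<in> Z; isomorphic C x y\<rbrakk> \<Longrightarrow> y \<in> Z"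
    and x: "x \<in> slice_class C Z c" and xy: "isomorphic (slice C c) x y"
  shows "y \<in> slice_class C Z c"
proof -
  obtain f g where fg: "f \<in> hom (slice C c) x y" "g \<in> hom (slice C c) y x"
    "g \<cdot>\<^bsub>slice C c\<^esub> f = Id (slice C c) x" "f \<cdot>\<^bsub>slice C c\<^esub> g = Id (slice C c) y" and y: "y \<in> Obj (slice C c)"
    using xy unfolding isomorphic_def by blast
  obtain f' where f': "f = (x, f', y)" "f' \<in> Arr C" "Dom C f' = Dom C x" "Cod C f' = Dom C y"
    using fg(1) by (rule slice_homE)
  obtain g' where g': "g = (y, g', x)" "g' \<in> Arr C" "Dom C g' = Dom C y" "Cod C g' = Dom C x"
    using fg(2) by (rule slice_homE)
  have "f' \<in> hom C (Dom C x) (Dom C y)" "g' \<in> hom C (Dom C y) (Dom C x)"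
    "g' \<cdot> f' = Id C (Dom C x)" "f' \<cdot> g' = Id C (Dom C y)"
    using fg(3,4) f' g' by (simp_all add: hom_iff)
  moreover have "Dom C x \<in> Obj C" "Dom C y \<in> Obj C"
    using x y by (simp_all add: slice_class_iff dom_in_obj)
  ultimately have "isomorphic C (Dom C x) (Dom C y)" unfolding isomorphic_def by blast
  then show ?thesis using iso x y by (auto simp: slice_class_iff)
qed

lemma slice_prenormal:
  assumes C: "prenormal C Z" and c: "c \<in> Obj C"
  shows "prenormal (slice C c) (slice_class C Z c)"
proof (rule prenormal_by_joint_reflection[where I = "UNIV :: unit set" and U = "\<lambda>_. slice_domain C", OF C])
  note CD = prenormalD[OF C]
  show "category (slice C c)" using slice_category[OF c] .
  show "slice_class C Z c \<subseteq> Obj (slice C c)" by (auto simp: slice_class_def)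
  have "\<And>x y. \<lbrakk>x \<in> Z; isomorphic C x y\<rbrakk> \<Longrightarrow> y \<in> Z"
    using CD(1) unfolding mono_coreflective_def by blast
  then show "\<And>x y. \<lbrakk>x \<in> slice_class C Z c; isomorphic (slice C c) x y\<rbrakk> \<Longrightarrow> y \<in> slice_class C Z c"
    using slice_class_iso_closed by blast
  show "has_finite_limits (slice C c)" using slice_has_finite_limits[OF CD(2) c] .
  show "is_functor (slice C c) C (slice_domain C)" using slice_domain_functor[OF c] .
next
  fix y assume y: "y \<in> Obj (slice C c)"
  then obtain e where e: "coreflection C Z (Dom C y) e"
    using mono_coreflectiveD[OF prenormalD(1)[OF C], of "Dom C y"] dom_in_obj[of y] by auto
  show "\<exists>e. coreflection (slice C c) (slice_class C Z c) y e \<and>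
      (\<forall>i \<in> (UNIV :: unit set). coreflection C Z (fobj (slice_domain C) y) (farr (slice_domain C) e))"
    using slice_coreflection[OF y e] e by (intro exI[of _ "(y \<cdot> e, e, y)"]) simp
next
  fix f g g' f' assume "is_pullback (slice C c) f g g' f'"
  then show "is_pullback C (farr (slice_domain C) f) (farr (slice_domain C) g)
      (farr (slice_domain C) g') (farr (slice_domain C) f')"
    by (rule slice_domain_preserves_pullbacks[OF c])
next
  fix f k assume k: "is_Z_kernel (slice C c) (slice_class C Z c) f k"
    "\<forall>i \<in> (UNIV :: unit set). \<exists>q. is_Z_cokernel C Z (farr (slice_domain C) k) q"
  show "\<exists>q \<in> Arr (slice C c). Dom (slice C c) q = Cod (slice C c) k \<and>
      (\<forall>i \<in> (UNIV :: unit set). is_Z_cokernel C Z (farr (slice_domain C) k) (farr (slice_domain C) q))"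
    using slice_cokernel_lift[OF k(1)] k(2) by blast
next
  fix k q assume "k \<in> Arr (slice C c)" "q \<in> Arr (slice C c)" "Dom (slice C c) q = Cod (slice C c) k"
    "\<forall>i \<in> (UNIV :: unit set). is_Z_cokernel C Z (farr (slice_domain C) k) (farr (slice_domain C) q)"
  then show "is_Z_cokernel (slice C c) (slice_class C Z c) k q"
    using slice_cokernelI by (cases k, cases q) auto
qed

end

section \<open>Functor categories\<close>

definition evaluation :: "'p \<Rightarrow>
   (('p, 'b, 'o, 'a) functor_data,
    ('p, 'b, 'o, 'a) functor_data \<times> ('p \<Rightarrow> 'a) \<times> ('p, 'b, 'o, 'a) functor_data, 'o, 'a) functor_data"
  where
  "evaluation b = \<lparr>fobj = (\<lambda>F. fobj F b), farr = (\<lambda>u. fst (snd u) b)\<rparr>"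

lemma evaluation_sel [simp]:
  "fobj (evaluation b) F = fobj F b" "farr (evaluation b) u = fst (snd u) b"
  by (simp_all add: evaluation_def)

locale functor_category_setup = B: category B + C: category C
  for B :: "('p, 'b) category" and C :: "('o, 'a) category"
begin

abbreviation "FC \<equiv> functor_category B C"

lemma FC_obj_iff:
  "F \<in> Obj FC \<longleftrightarrow> is_functor B C F \<and> fobj F \<in> extensional (Obj B) \<and> farr F \<in> extensional (Arr B)"
  by (simp add: functor_category_def Let_def)

lemma FC_arr_iff:
  "(F, \<tau>, G) \<in> Arr FC \<longleftrightarrow> F \<in> Obj FC \<and> G \<in> Obj FC \<and> is_nat_trans B C F G \<tau> \<and> \<tau> \<in> extensional (Obj B)"
  by (simp add: functor_category_def Let_def)

lemma FC_sel [simp]: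
  "Dom FC u = fst u" "Cod FC u = snd (snd u)"
  "Id FC F = (F, (\<lambda>b \<in> Obj B. Id C (fobj F b)), F)"
  "v \<cdot>\<^bsub>FC\<^esub> u = (fst u, (\<lambda>b \<in> Obj B. fst (snd v) b \<cdot>\<^bsub>C\<^esub> fst (snd u) b), snd (snd v))"
  by (auto simp: functor_category_def Let_def split: prod.splits)

lemma FC_obj:
  assumes "F \<in> Obj FC"
  shows "is_functor B C F"
    "b \<in> Obj B \<Longrightarrow> fobj F b \<in> Obj C"
    "\<beta> \<in> Arr B \<Longrightarrow> farr F \<beta> \<in> Arr C"
    "\<beta> \<in> Arr B \<Longrightarrow> Dom C (farr F \<beta>) = fobj F (Dom B \<beta>)"
    "\<beta> \<in> Arr B \<Longrightarrow> Cod C (farr F \<beta>) = fobj F (Cod B \<beta>)"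
    "b \<in> Obj B \<Longrightarrow> farr F (Id B b) = Id C (fobj F b)"
    "\<lbrakk>\<beta> \<in> Arr B; \<gamma> \<in> Arr B; Cod B \<beta> = Dom B \<gamma>\<rbrakk> \<Longrightarrow>
       farr F (\<gamma> \<cdot>\<^bsub>B\<^esub> \<beta>) = farr F \<gamma> \<cdot>\<^bsub>C\<^esub> farr F \<beta>"
  using assms functorD[of B C F] by (auto simp: FC_obj_iff)

lemma FC_arr:
  assumes "u \<in> Arr FC"
  shows "fst u \<in> Obj FC" "snd (snd u) \<in> Obj FC"
    "b \<in> Obj B \<Longrightarrow> fst (snd u) b \<in> Arr C"
    "b \<in> Obj B \<Longrightarrow> Dom C (fst (snd u) b) = fobj (fst u) b"
    "b \<in> Obj B \<Longrightarrow> Cod C (fst (snd u) b) = fobj (snd (snd u)) b"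
    "\<beta> \<in> Arr B \<Longrightarrow> fst (snd u) (Cod B \<beta>) \<cdot>\<^bsub>C\<^esub> farr (fst u) \<beta> =
       farr (snd (snd u)) \<beta> \<cdot>\<^bsub>C\<^esub> fst (snd u) (Dom B \<beta>)"
proof -
  obtain F \<tau> G where u: "u = (F, \<tau>, G)" by (cases u) auto
  have *: "F \<in> Obj FC" "G \<in> Obj FC" "is_nat_trans B C F G \<tau>"
    using assms by (simp_all add: u FC_arr_iff)
  then show "fst u \<in> Obj FC" "snd (snd u) \<in> Obj FC"
    "b \<in> Obj B \<Longrightarrow> fst (snd u) b \<in> Arr C"
    "b \<in> Obj B \<Longrightarrow> Dom C (fst (snd u) b) = fobj (fst u) b"
    "b \<in> Obj B \<Longrightarrow> Cod C (fst (snd u) b) = fobj (snd (snd u)) b"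
    "\<beta> \<in> Arr B \<Longrightarrow> fst (snd u) (Cod B \<beta>) \<cdot>\<^bsub>C\<^esub> farr (fst u) \<beta> =
       farr (snd (snd u)) \<beta> \<cdot>\<^bsub>C\<^esub> fst (snd u) (Dom B \<beta>)"
    by (simp_all add: u is_nat_trans_def C.hom_iff)
qed

lemma FC_arrI:
  assumes "F \<in> Obj FC" "G \<in> Obj FC"
    and "\<And>b. b \<in> Obj B \<Longrightarrow> \<tau> b \<in> hom C (fobj F b) (fobj G b)"
    and "\<And>\<beta>. \<beta> \<in> Arr B \<Longrightarrow> \<tau> (Cod B \<beta>) \<cdot>\<^bsub>C\<^esub> farr F \<beta> = farr G \<beta> \<cdot>\<^bsub>C\<^esub> \<tau> (Dom B \<beta>)"
  shows "(F, restrict \<tau> (Obj B), G) \<in> Arr FC"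
  using assms by (simp add: FC_arr_iff is_nat_trans_def FC_obj(1) B.dom_in_obj B.cod_in_obj)

lemma FC_arr_eqI:
  assumes "u \<in> Arr FC" "v \<in> Arr FC" "fst u = fst v" "snd (snd u) = snd (snd v)"
    and "\<And>b. b \<in> Obj B \<Longrightarrow> fst (snd u) b = fst (snd v) b"
  shows "u = v"
proof -
  have "fst (snd u) \<in> extensional (Obj B)" "fst (snd v) \<in> extensional (Obj B)"
    using assms(1,2) by (cases u, simp add: FC_arr_iff, cases v, simp add: FC_arr_iff)
  then have "fst (snd u) = fst (snd v)" using assms(5) by (rule extensionalityI)
  then show ?thesis using assms(3,4) by (simp add: prod_eq_iff)
qed

lemma FC_hom_iff: "u \<in> hom FC F G \<longleftrightarrow> u \<in> Arr FC \<and> fst u = F \<and> snd (snd u) = G"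
  by (simp add: hom_def)

lemma FC_comp_arr:
  assumes u: "u \<in> Arr FC" and v: "v \<in> Arr FC" and uv: "snd (snd u) = fst v"
  shows "v \<cdot>\<^bsub>FC\<^esub> u \<in> Arr FC"
  unfolding FC_sel
proof (rule FC_arrI)
  note U = FC_arr[OF u] and V = FC_arr[OF v]
  note F = FC_obj[OF U(1)] and G = FC_obj[OF U(2)] and H = FC_obj[OF V(2)]
  show "fst u \<in> Obj FC" "snd (snd v) \<in> Obj FC" using U(1) V(2) .
  show "fst (snd v) b \<cdot>\<^bsub>C\<^esub> fst (snd u) b \<in> hom C (fobj (fst u) b) (fobj (snd (snd v)) b)"
    if "b \<in> Obj B" for b
    using U(3-5)[OF that] V(3-5)[OF that] uv by (simp add: C.cat_simps)
  fix \<beta> assume \<beta>: "\<beta> \<in> Arr B"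
  note d = B.dom_in_obj[OF \<beta>] and c = B.cod_in_obj[OF \<beta>]
  note ty = U(3-5)[OF d] U(3-5)[OF c] V(3-5)[OF d] V(3-5)[OF c] F(3-5)[OF \<beta>] G(3-5)[OF \<beta>] H(3-5)[OF \<beta>]
  have "fst (snd v) (Cod B \<beta>) \<cdot>\<^bsub>C\<^esub> fst (snd u) (Cod B \<beta>) \<cdot>\<^bsub>C\<^esub> farr (fst u) \<beta> =
      fst (snd v) (Cod B \<beta>) \<cdot>\<^bsub>C\<^esub> (fst (snd u) (Cod B \<beta>) \<cdot>\<^bsub>C\<^esub> farr (fst u) \<beta>)"
    using ty uv by (simp add: C.assoc)
  also have "\<dots> = fst (snd v) (Cod B \<beta>) \<cdot>\<^bsub>C\<^esub> farr (fst v) \<beta> \<cdot>\<^bsub>C\<^esub> fst (snd u) (Dom B \<beta>)"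
    using ty uv by (simp add: C.assoc U(6)[OF \<beta>])
  also have "\<dots> = farr (snd (snd v)) \<beta> \<cdot>\<^bsub>C\<^esub> (fst (snd v) (Dom B \<beta>) \<cdot>\<^bsub>C\<^esub> fst (snd u) (Dom B \<beta>))"
    unfolding V(6)[OF \<beta>] using ty uv by (simp add: C.assoc)
  finally show "fst (snd v) (Cod B \<beta>) \<cdot>\<^bsub>C\<^esub> fst (snd u) (Cod B \<beta>) \<cdot>\<^bsub>C\<^esub> farr (fst u) \<beta> =
      farr (snd (snd v)) \<beta> \<cdot>\<^bsub>C\<^esub> (fst (snd v) (Dom B \<beta>) \<cdot>\<^bsub>C\<^esub> fst (snd u) (Dom B \<beta>))" .
qed

lemma FC_id_arr: "F \<in> Obj FC \<Longrightarrow> Id FC F \<in> Arr FC"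
  unfolding FC_sel
  by (rule FC_arrI) (simp_all add: FC_obj C.cat_simps B.dom_in_obj B.cod_in_obj)

lemma FC_category: "category FC"
proof
  fix F G u assume u: "u \<in> hom FC F G"
  then have "u \<in> Arr FC" "fst u = F" "snd (snd u) = G" by (simp_all add: FC_hom_iff)
  note U = FC_arr[OF this(1)] and u' = this
  show "u \<cdot>\<^bsub>FC\<^esub> Id FC F = u"
    by (rule FC_arr_eqI[OF FC_comp_arr])
      (use U u' in \<open>simp_all add: FC_id_arr[unfolded FC_sel] C.cat_simps\<close>)
  show "Id FC G \<cdot>\<^bsub>FC\<^esub> u = u"
    by (rule FC_arr_eqI[OF FC_comp_arr])
      (use U u' in \<open>simp_all add: FC_id_arr[unfolded FC_sel] C.cat_simps\<close>)
next
  fix F G H K u v w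
  assume "u \<in> hom FC F G" "v \<in> hom FC G H" "w \<in> hom FC H K"
  then have u: "u \<in> Arr FC" "fst u = F" "snd (snd u) = G" and v: "v \<in> Arr FC" "fst v = G" "snd (snd v) = H"
    and w: "w \<in> Arr FC" "fst w = H" "snd (snd w) = K"
    by (simp_all add: FC_hom_iff)
  note ty = FC_arr(3-5)[OF u(1)] FC_arr(3-5)[OF v(1)] FC_arr(3-5)[OF w(1)]
  have "w \<cdot>\<^bsub>FC\<^esub> v \<in> Arr FC" "v \<cdot>\<^bsub>FC\<^esub> u \<in> Arr FC"
    using u v w by (auto intro!: FC_comp_arr simp del: FC_sel)
  then have "w \<cdot>\<^bsub>FC\<^esub> v \<cdot>\<^bsub>FC\<^esub> u \<in> Arr FC" "w \<cdot>\<^bsub>FC\<^esub> (v \<cdot>\<^bsub>FC\<^esub> u) \<in> Arr FC"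
    using u v w FC_comp_arr[of u "w \<cdot>\<^bsub>FC\<^esub> v"] FC_comp_arr[of "v \<cdot>\<^bsub>FC\<^esub> u" w] by simp_all
  then show "w \<cdot>\<^bsub>FC\<^esub> v \<cdot>\<^bsub>FC\<^esub> u = w \<cdot>\<^bsub>FC\<^esub> (v \<cdot>\<^bsub>FC\<^esub> u)"
    by (rule FC_arr_eqI) (use ty u v w in \<open>simp_all add: C.assoc\<close>)
next
  fix F G H u v assume "u \<in> hom FC F G" "v \<in> hom FC G H"
  then show "v \<cdot>\<^bsub>FC\<^esub> u \<in> hom FC F H"
    using FC_comp_arr[of u v] by (simp add: FC_hom_iff)
qed (use FC_arr FC_id_arr in \<open>simp_all add: FC_hom_iff\<close>)

sublocale FC: category FC by (rule FC_category)

lemma evaluation_functor: "b \<in> Obj B \<Longrightarrow> is_functor FC C (evaluation b)"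
  by (rule functorI) (simp_all add: FC_category C.category_axioms FC_obj FC_arr C.hom_iff)

text \<open>A functor given on objects and pinned down on arrows by a property \<open>R\<close>: when exactly one
  arrow satisfies \<open>R \<beta>\<close> for each \<open>\<beta>\<close>, and \<open>R\<close> is compatible with identities and composition,
  functoriality comes for free. Subobjects, quotients and limits of functors are all made this way,
  with \<open>R\<close> the naturality of the counits, projections or limit cones.\<close>

lemma FC_functor_by_unique_arrows:
  assumes ob: "\<And>b. b \<in> Obj B \<Longrightarrow> ob b \<in> Obj C"
    and ex1: "\<And>\<beta>. \<beta> \<in> Arr B \<Longrightarrow> \<exists>!h. h \<in> hom C (ob (Dom B \<beta>)) (ob (Cod B \<beta>)) \<and> R \<beta> h"
    and R_id: "\<And>b. b \<in> Obj B \<Longrightarrow> R (Id B b) (Id C (ob b))"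
    and R_comp: "\<And>\<beta> \<gamma> h k. \<lbrakk>\<beta> \<in> Arr B; \<gamma> \<in> Arr B; Cod B \<beta> = Dom B \<gamma>;
      h \<in> hom C (ob (Dom B \<beta>)) (ob (Cod B \<beta>)); k \<in> hom C (ob (Dom B \<gamma>)) (ob (Cod B \<gamma>));
      R \<beta> h; R \<gamma> k\<rbrakk> \<Longrightarrow> R (\<gamma> \<cdot>\<^bsub>B\<^esub> \<beta>) (k \<cdot>\<^bsub>C\<^esub> h)"
  obtains L where "L \<in> Obj FC" "\<And>b. b \<in> Obj B \<Longrightarrow> fobj L b = ob b"
    "\<And>\<beta>. \<beta> \<in> Arr B \<Longrightarrow> R \<beta> (farr L \<beta>)"
proof -
  obtain ar where ar: "\<And>\<beta>. \<beta> \<in> Arr B \<Longrightarrow> ar \<beta> \<in> hom C (ob (Dom B \<beta>)) (ob (Cod B \<beta>))"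
      "\<And>\<beta>. \<beta> \<in> Arr B \<Longrightarrow> R \<beta> (ar \<beta>)"
    using ex1 by metis
  have uniq: "h = ar \<beta>" if "\<beta> \<in> Arr B" "h \<in> hom C (ob (Dom B \<beta>)) (ob (Cod B \<beta>))" "R \<beta> h" for \<beta> h
    using ex1[OF that(1)] ar[OF that(1)] that(2,3) by blast
  define L :: "('p, 'b, 'o, 'a) functor_data"
    where "L = \<lparr>fobj = restrict ob (Obj B), farr = restrict ar (Arr B)\<rparr>"
  have "is_functor B C L"
  proof (rule functorI)
    fix b assume b: "b \<in> Obj B"
    have "Id C (ob b) = ar (Id B b)"
      by (rule uniq) (use b R_id ob in \<open>simp_all add: B.cat_simps C.cat_simps\<close>)
    then show "farr L (Id B b) = Id C (fobj L b)" using b by (simp add: L_def B.cat_simps)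
  next
    fix \<beta> \<gamma> assume \<beta>\<gamma>: "\<beta> \<in> Arr B" "\<gamma> \<in> Arr B" "Cod B \<beta> = Dom B \<gamma>"
    have "ar \<gamma> \<cdot>\<^bsub>C\<^esub> ar \<beta> = ar (\<gamma> \<cdot>\<^bsub>B\<^esub> \<beta>)"
      by (rule uniq)
        (use \<beta>\<gamma> ar(1)[OF \<beta>\<gamma>(1)] ar(1)[OF \<beta>\<gamma>(2)] R_comp ar in \<open>simp_all add: B.cat_simps C.cat_simps\<close>)
    then show "farr L (\<gamma> \<cdot>\<^bsub>B\<^esub> \<beta>) = farr L \<gamma> \<cdot>\<^bsub>C\<^esub> farr L \<beta>"
      using \<beta>\<gamma> by (simp add: L_def B.cat_simps)
  qed (use ob ar in \<open>simp_all add: L_def B.category_axioms C.category_axioms B.dom_in_obj B.cod_in_obj\<close>)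
  then have "L \<in> Obj FC" by (simp add: FC_obj_iff L_def)
  then show ?thesis using that[of L] ar by (simp add: L_def)
qed

text \<open>Pointwise factorizations through a pointwise mono are natural, since naturality can be tested
  after composing with the mono. The next lemma is the dual, where in addition uniqueness is
  recorded.\<close>

lemma FC_factor_through_pointwise_mono:
  assumes m: "m \<in> Arr FC" "\<And>b. b \<in> Obj B \<Longrightarrow> is_mono C (fst (snd m) b)"
    and u: "u \<in> Arr FC" "snd (snd u) = snd (snd m)"
    and ex: "\<And>b. b \<in> Obj B \<Longrightarrow> \<exists>g \<in> hom C (fobj (fst u) b) (fobj (fst m) b).
      fst (snd m) b \<cdot>\<^bsub>C\<^esub> g = fst (snd u) b"
  shows "\<exists>g \<in> hom FC (fst u) (fst m). m \<cdot>\<^bsub>FC\<^esub> g = u"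
proof -
  note M = FC_arr[OF m(1)] and U = FC_arr[OF u(1)]
  obtain g where g: "\<And>b. b \<in> Obj B \<Longrightarrow> g b \<in> hom C (fobj (fst u) b) (fobj (fst m) b)"
    and mg: "\<And>b. b \<in> Obj B \<Longrightarrow> fst (snd m) b \<cdot>\<^bsub>C\<^esub> g b = fst (snd u) b"
    using ex by metis
  have g': "g b \<in> Arr C" "Dom C (g b) = fobj (fst u) b" "Cod C (g b) = fobj (fst m) b" if "b \<in> Obj B" for b
    using g[OF that] by (simp_all add: C.hom_iff)
  let ?g = "(fst u, restrict g (Obj B), fst m)"
  have arr: "?g \<in> Arr FC"
  proof (rule FC_arrI)
    fix \<beta> assume \<beta>: "\<beta> \<in> Arr B"
    note d = B.dom_in_obj[OF \<beta>] and c = B.cod_in_obj[OF \<beta>]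
    note ty = M(3-5)[OF d] M(3-5)[OF c] g'[OF d] g'[OF c] FC_obj(3-5)[OF M(1) \<beta>] FC_obj(3-5)[OF U(1) \<beta>]
      FC_obj(3-5)[OF M(2) \<beta>]
    show "g (Cod B \<beta>) \<cdot>\<^bsub>C\<^esub> farr (fst u) \<beta> = farr (fst m) \<beta> \<cdot>\<^bsub>C\<^esub> g (Dom B \<beta>)"
    proof (rule C.mono_cancel[OF m(2)[OF c]])
      have "fst (snd m) (Cod B \<beta>) \<cdot>\<^bsub>C\<^esub> (g (Cod B \<beta>) \<cdot>\<^bsub>C\<^esub> farr (fst u) \<beta>) =
          fst (snd u) (Cod B \<beta>) \<cdot>\<^bsub>C\<^esub> farr (fst u) \<beta>"
        using ty mg[OF c] by (simp flip: C.assoc)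
      also have "\<dots> = farr (snd (snd m)) \<beta> \<cdot>\<^bsub>C\<^esub> (fst (snd m) (Dom B \<beta>) \<cdot>\<^bsub>C\<^esub> g (Dom B \<beta>))"
        using U(6)[OF \<beta>] mg[OF d] u(2) by simp
      also have "\<dots> = farr (snd (snd m)) \<beta> \<cdot>\<^bsub>C\<^esub> fst (snd m) (Dom B \<beta>) \<cdot>\<^bsub>C\<^esub> g (Dom B \<beta>)"
        using ty by (simp add: C.assoc)
      also have "\<dots> = fst (snd m) (Cod B \<beta>) \<cdot>\<^bsub>C\<^esub> (farr (fst m) \<beta> \<cdot>\<^bsub>C\<^esub> g (Dom B \<beta>))"
        unfolding M(6)[OF \<beta>, symmetric] using ty by (simp add: C.assoc)
      finally show "fst (snd m) (Cod B \<beta>) \<cdot>\<^bsub>C\<^esub> (g (Cod B \<beta>) \<cdot>\<^bsub>C\<^esub> farr (fst u) \<beta>) =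
          fst (snd m) (Cod B \<beta>) \<cdot>\<^bsub>C\<^esub> (farr (fst m) \<beta> \<cdot>\<^bsub>C\<^esub> g (Dom B \<beta>))" .
    qed (use ty in \<open>simp_all add: C.comp_typing\<close>)
  qed (use U(1) M(1) g in simp_all)
  have "m \<cdot>\<^bsub>FC\<^esub> ?g = u"
    by (rule FC_arr_eqI[OF FC_comp_arr[OF arr m(1)] u(1)]) (use mg u(2) in simp_all)
  moreover have "?g \<in> hom FC (fst u) (fst m)" using arr by (simp add: FC_hom_iff)
  ultimately show ?thesis by blast
qed

lemma FC_factor_through_pointwise_epi:
  assumes q: "q \<in> Arr FC"
    and epi: "\<And>b s t. \<lbrakk>b \<in> Obj B; s \<in> Arr C; t \<in> Arr C; Dom C s = fobj (snd (snd q)) b;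
      Dom C t = fobj (snd (snd q)) b; Cod C s = Cod C t;
      s \<cdot>\<^bsub>C\<^esub> fst (snd q) b = t \<cdot>\<^bsub>C\<^esub> fst (snd q) b\<rbrakk> \<Longrightarrow> s = t"
    and u: "u \<in> Arr FC" "fst u = fst q"
    and ex: "\<And>b. b \<in> Obj B \<Longrightarrow> \<exists>g \<in> hom C (fobj (snd (snd q)) b) (fobj (snd (snd u)) b).
      g \<cdot>\<^bsub>C\<^esub> fst (snd q) b = fst (snd u) b"
  shows "\<exists>!g. g \<in> hom FC (snd (snd q)) (snd (snd u)) \<and> g \<cdot>\<^bsub>FC\<^esub> q = u"
proof -
  note Q = FC_arr[OF q] and U = FC_arr[OF u(1)]
  obtain g where g: "\<And>b. b \<in> Obj B \<Longrightarrow> g b \<in> hom C (fobj (snd (snd q)) b) (fobj (snd (snd u)) b)"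
    and gq: "\<And>b. b \<in> Obj B \<Longrightarrow> g b \<cdot>\<^bsub>C\<^esub> fst (snd q) b = fst (snd u) b"
    using ex by metis
  have g': "g b \<in> Arr C" "Dom C (g b) = fobj (snd (snd q)) b" "Cod C (g b) = fobj (snd (snd u)) b"
    if "b \<in> Obj B" for b
    using g[OF that] by (simp_all add: C.hom_iff)
  let ?g = "(snd (snd q), restrict g (Obj B), snd (snd u))"
  have arr: "?g \<in> Arr FC"
  proof (rule FC_arrI)
    fix \<beta> assume \<beta>: "\<beta> \<in> Arr B"
    note d = B.dom_in_obj[OF \<beta>] and c = B.cod_in_obj[OF \<beta>]
    note ty = Q(3-5)[OF d] Q(3-5)[OF c] g'[OF d] g'[OF c] FC_obj(3-5)[OF Q(1) \<beta>] FC_obj(3-5)[OF Q(2) \<beta>]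
      FC_obj(3-5)[OF U(2) \<beta>]
    show "g (Cod B \<beta>) \<cdot>\<^bsub>C\<^esub> farr (snd (snd q)) \<beta> = farr (snd (snd u)) \<beta> \<cdot>\<^bsub>C\<^esub> g (Dom B \<beta>)"
    proof (rule epi[OF d])
      have "g (Cod B \<beta>) \<cdot>\<^bsub>C\<^esub> farr (snd (snd q)) \<beta> \<cdot>\<^bsub>C\<^esub> fst (snd q) (Dom B \<beta>) =
          g (Cod B \<beta>) \<cdot>\<^bsub>C\<^esub> (fst (snd q) (Cod B \<beta>) \<cdot>\<^bsub>C\<^esub> farr (fst q) \<beta>)"
        unfolding Q(6)[OF \<beta>] using ty by (simp add: C.assoc)
      also have "\<dots> = g (Cod B \<beta>) \<cdot>\<^bsub>C\<^esub> fst (snd q) (Cod B \<beta>) \<cdot>\<^bsub>C\<^esub> farr (fst q) \<beta>"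
        using ty by (simp add: C.assoc)
      also have "\<dots> = farr (snd (snd u)) \<beta> \<cdot>\<^bsub>C\<^esub> (g (Dom B \<beta>) \<cdot>\<^bsub>C\<^esub> fst (snd q) (Dom B \<beta>))"
        using U(6)[OF \<beta>] gq[OF d] gq[OF c] u(2) by simp
      also have "\<dots> = farr (snd (snd u)) \<beta> \<cdot>\<^bsub>C\<^esub> g (Dom B \<beta>) \<cdot>\<^bsub>C\<^esub> fst (snd q) (Dom B \<beta>)"
        using ty by (simp add: C.assoc)
      finally show "g (Cod B \<beta>) \<cdot>\<^bsub>C\<^esub> farr (snd (snd q)) \<beta> \<cdot>\<^bsub>C\<^esub> fst (snd q) (Dom B \<beta>) =
          farr (snd (snd u)) \<beta> \<cdot>\<^bsub>C\<^esub> g (Dom B \<beta>) \<cdot>\<^bsub>C\<^esub> fst (snd q) (Dom B \<beta>)" .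
    qed (use ty in \<open>simp_all add: C.comp_typing\<close>)
  qed (use U(2) Q(2) g in simp_all)
  have gq': "?g \<cdot>\<^bsub>FC\<^esub> q = u"
    by (rule FC_arr_eqI[OF FC_comp_arr[OF q arr] u(1)]) (use gq u(2) in simp_all)
  show ?thesis
  proof
    show "?g \<in> hom FC (snd (snd q)) (snd (snd u)) \<and> ?g \<cdot>\<^bsub>FC\<^esub> q = u"
      using arr gq' by (simp add: FC_hom_iff)
    fix h assume h: "h \<in> hom FC (snd (snd q)) (snd (snd u)) \<and> h \<cdot>\<^bsub>FC\<^esub> q = u"
    then have h': "h \<in> Arr FC" "fst h = snd (snd q)" "snd (snd h) = snd (snd u)" by (simp_all add: FC_hom_iff)
    show "h = ?g"
    proof (rule FC_arr_eqI[OF h'(1) arr])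
      fix b assume b: "b \<in> Obj B"
      have "fst (snd (h \<cdot>\<^bsub>FC\<^esub> q)) b = fst (snd u) b" using h by simp
      then have eq: "fst (snd h) b \<cdot>\<^bsub>C\<^esub> fst (snd q) b = g b \<cdot>\<^bsub>C\<^esub> fst (snd q) b"
        using b gq by simp
      have "fst (snd h) b = g b"
        by (rule epi[OF b _ _ _ _ _ eq]) (use FC_arr(3-5)[OF h'(1) b] h' g'[OF b] in simp_all)
      then show "fst (snd h) b = fst (snd ?g) b" using b by simp
    qed (use h' in simp_all)
  qed
qed

lemma functor_class_iff: "F \<in> functor_class B C Z \<longleftrightarrow> F \<in> Obj FC \<and> (\<forall>b \<in> Obj B. fobj F b \<in> Z)"
  by (simp add: functor_class_def)

text \<open>The counits at the values of \<open>F\<close> form a natural transformation from a functor \<open>L\<close> with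
  values in \<open>Z\<close>, which is the coreflection of \<open>F\<close>.\<close>

lemma FC_pointwise_coreflection:
  assumes core: "\<And>y. y \<in> Obj C \<Longrightarrow> \<exists>e. coreflection C Z y e" and F: "F \<in> Obj FC"
  obtains E where "E \<in> Arr FC" "coreflection FC (functor_class B C Z) F E"
    "\<forall>b \<in> Obj B. coreflection C Z (fobj F b) (fst (snd E) b)"
proof -
  note FD = FC_obj[OF F]
  have "\<forall>b \<in> Obj B. \<exists>e. coreflection C Z (fobj F b) e" using core FD(2) by blast
  then obtain e where e: "\<And>b. b \<in> Obj B \<Longrightarrow> coreflection C Z (fobj F b) (e b)"
    by metis
  have e': "e b \<in> Arr C" "Cod C (e b) = fobj F b" "Dom C (e b) \<in> Z" "is_mono C (e b)" if "b \<in> Obj B" for b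
    using coreflectionD[OF e[OF that]] by simp_all
  let ?R = "\<lambda>\<beta> h. e (Cod B \<beta>) \<cdot>\<^bsub>C\<^esub> h = farr F \<beta> \<cdot>\<^bsub>C\<^esub> e (Dom B \<beta>)"
  obtain L where L: "L \<in> Obj FC" "\<And>b. b \<in> Obj B \<Longrightarrow> fobj L b = Dom C (e b)"
    "\<And>\<beta>. \<beta> \<in> Arr B \<Longrightarrow> ?R \<beta> (farr L \<beta>)"
  proof (rule FC_functor_by_unique_arrows[of "\<lambda>b. Dom C (e b)" ?R])
    fix \<beta> assume \<beta>: "\<beta> \<in> Arr B"
    note d = e'[OF B.dom_in_obj[OF \<beta>]] and c = e'[OF B.cod_in_obj[OF \<beta>]]
    let ?f = "farr F \<beta> \<cdot>\<^bsub>C\<^esub> e (Dom B \<beta>)"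
    have f: "?f \<in> Arr C" "Dom C ?f = Dom C (e (Dom B \<beta>))" "Cod C ?f = fobj F (Cod B \<beta>)"
      using d FD(3-5)[OF \<beta>] by (simp_all add: C.comp_typing)
    obtain h where h: "h \<in> hom C (Dom C (e (Dom B \<beta>))) (Dom C (e (Cod B \<beta>)))" "?R \<beta> h"
      using coreflection_factor[OF e[OF B.cod_in_obj[OF \<beta>]] f(1)] f d(3) by metis
    show "\<exists>!h. h \<in> hom C (Dom C (e (Dom B \<beta>))) (Dom C (e (Cod B \<beta>))) \<and> ?R \<beta> h"
    proof (rule ex1I[of _ h])
      fix h' assume h': "h' \<in> hom C (Dom C (e (Dom B \<beta>))) (Dom C (e (Cod B \<beta>))) \<and> ?R \<beta> h'"
      show "h' = h"
        by (rule C.mono_cancel[OF c(4)]) (use h h' in \<open>simp_all add: C.hom_iff\<close>)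
    qed (use h in simp)
  next
    fix b assume "b \<in> Obj B"
    then show "?R (Id B b) (Id C (Dom C (e b)))"
      using e' FD(6) by (simp add: B.cat_simps C.cat_simps)
  next
    fix \<beta> \<gamma> h k
    assume \<beta>\<gamma>: "\<beta> \<in> Arr B" "\<gamma> \<in> Arr B" "Cod B \<beta> = Dom B \<gamma>"
      and h: "h \<in> hom C (Dom C (e (Dom B \<beta>))) (Dom C (e (Cod B \<beta>)))" "?R \<beta> h"
      and k: "k \<in> hom C (Dom C (e (Dom B \<gamma>))) (Dom C (e (Cod B \<gamma>)))" "?R \<gamma> k"
    note ty = e'(1,2)[OF B.dom_in_obj[OF \<beta>\<gamma>(1)]] e'(1,2)[OF B.cod_in_obj[OF \<beta>\<gamma>(1)]]
      e'(1,2)[OF B.cod_in_obj[OF \<beta>\<gamma>(2)]] FD(3-5)[OF \<beta>\<gamma>(1)] FD(3-5)[OF \<beta>\<gamma>(2)]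
    have "e (Cod B \<gamma>) \<cdot>\<^bsub>C\<^esub> (k \<cdot>\<^bsub>C\<^esub> h) = farr F \<gamma> \<cdot>\<^bsub>C\<^esub> e (Dom B \<gamma>) \<cdot>\<^bsub>C\<^esub> h"
      using ty h(1) k \<beta>\<gamma>(3) by (simp add: C.hom_iff flip: C.assoc)
    also have "\<dots> = farr F \<gamma> \<cdot>\<^bsub>C\<^esub> farr F \<beta> \<cdot>\<^bsub>C\<^esub> e (Dom B \<beta>)"
      using ty h k(1) \<beta>\<gamma>(3) by (simp add: C.hom_iff C.assoc)
    finally show "?R (\<gamma> \<cdot>\<^bsub>B\<^esub> \<beta>) (k \<cdot>\<^bsub>C\<^esub> h)"
      using \<beta>\<gamma> FD(7) by (simp add: B.comp_typing)
  qed (use e' in \<open>auto simp: C.dom_in_obj\<close>)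
  let ?E = "(L, restrict e (Obj B), F)"
  have E: "?E \<in> Arr FC"
    by (rule FC_arrI) (use L F e' in \<open>simp_all add: C.hom_iff\<close>)
  have "is_mono FC ?E"
    unfolding is_mono_def
  proof (intro conjI E allI ballI impI)
    fix X f g
    assume "f \<in> hom FC X (Dom FC ?E)" "g \<in> hom FC X (Dom FC ?E)" and eq: "?E \<cdot>\<^bsub>FC\<^esub> f = ?E \<cdot>\<^bsub>FC\<^esub> g"
    then have f: "f \<in> Arr FC" "fst f = X" "snd (snd f) = L" and g: "g \<in> Arr FC" "fst g = X" "snd (snd g) = L"
      by (simp_all add: FC_hom_iff)
    show "f = g"
    proof (rule FC_arr_eqI[OF f(1) g(1)])
      fix b assume b: "b \<in> Obj B"
      have "fst (snd (?E \<cdot>\<^bsub>FC\<^esub> f)) b = fst (snd (?E \<cdot>\<^bsub>FC\<^esub> g)) b" using eq by simp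
      then have "e b \<cdot>\<^bsub>C\<^esub> fst (snd f) b = e b \<cdot>\<^bsub>C\<^esub> fst (snd g) b" using b by simp
      then show "fst (snd f) b = fst (snd g) b"
        by (rule C.mono_cancel[OF e'(4)[OF b]])
          (use FC_arr(3-5)[OF f(1) b] FC_arr(3-5)[OF g(1) b] f g L(2)[OF b] in simp_all)
    qed (use f g in simp_all)
  qed
  moreover have "\<exists>g \<in> hom FC (Dom FC f) (Dom FC ?E). ?E \<cdot>\<^bsub>FC\<^esub> g = f"
    if f: "f \<in> Arr FC" "Dom FC f \<in> functor_class B C Z" "Cod FC f = F" for f
  proof -
    have "\<exists>g \<in> hom C (fobj (fst f) b) (fobj (fst ?E) b). fst (snd ?E) b \<cdot>\<^bsub>C\<^esub> g = fst (snd f) b"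
      if b: "b \<in> Obj B" for b
    proof -
      have "Dom C (fst (snd f) b) \<in> Z" "Cod C (fst (snd f) b) = fobj F b"
        using f FC_arr(3-5)[OF f(1) b] b by (simp_all add: functor_class_iff)
      then obtain g where "g \<in> hom C (Dom C (fst (snd f) b)) (Dom C (e b))" "e b \<cdot>\<^bsub>C\<^esub> g = fst (snd f) b"
        using coreflection_factor[OF e[OF b] FC_arr(3)[OF f(1) b]] by metis
      then show ?thesis using b L(2) FC_arr(4)[OF f(1) b] by auto
    qed
    then have "\<exists>g \<in> hom FC (fst f) (fst ?E). ?E \<cdot>\<^bsub>FC\<^esub> g = f"
      using e'(4) f(3) by (intro FC_factor_through_pointwise_mono[OF E _ f(1)]) simp_all
    then show ?thesis by (simp only: FC_sel(1))
  qed
  ultimately have "coreflection FC (functor_class B C Z) F ?E"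
    using L e'(3) by (simp add: coreflection_def functor_class_iff)
  then show ?thesis using that[OF E] e by simp
qed

lemma FC_trivial_pointwise:
  assumes "Z_trivial FC (functor_class B C Z) u" and b: "b \<in> Obj B"
  shows "Z_trivial C Z (fst (snd u) b)"
proof -
  obtain f g where fg: "f \<in> Arr FC" "g \<in> Arr FC" "Cod FC f = Dom FC g" "Dom FC g \<in> functor_class B C Z"
    "g \<cdot>\<^bsub>FC\<^esub> f = u"
    using FC.trivialE[OF assms(1)] by metis
  have "Z_trivial C Z (fst (snd g) b \<cdot>\<^bsub>C\<^esub> fst (snd f) b)"
    by (rule C.trivialI)
      (use fg(3,4) b FC_arr(3-5)[OF fg(1) b] FC_arr(3-5)[OF fg(2) b] in \<open>simp_all add: functor_class_iff\<close>)
  then show ?thesis using fg(5) b by auto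
qed

text \<open>The objects of \<open>Z\<close> through which the components factor need not depend functorially on \<open>b\<close>,
  but the components also factor through the counits, which do.\<close>

lemma FC_trivial_if_pointwise_trivial:
  assumes core: "\<And>y. y \<in> Obj C \<Longrightarrow> \<exists>e. coreflection C Z y e" and u: "u \<in> Arr FC"
    and triv: "\<And>b. b \<in> Obj B \<Longrightarrow> Z_trivial C Z (fst (snd u) b)"
  shows "Z_trivial FC (functor_class B C Z) u"
proof -
  note U = FC_arr[OF u]
  obtain E where E: "E \<in> Arr FC" "coreflection FC (functor_class B C Z) (snd (snd u)) E"
    "\<forall>b \<in> Obj B. coreflection C Z (fobj (snd (snd u)) b) (fst (snd E) b)"
    using FC_pointwise_coreflection[OF core U(2)] .
  note ED = coreflectionD[OF E(2)]
  have "\<exists>g \<in> hom C (fobj (fst u) b) (fobj (fst E) b). fst (snd E) b \<cdot>\<^bsub>C\<^esub> g = fst (snd u) b"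
    if b: "b \<in> Obj B" for b
    using C.trivial_iff_factors_through_coreflection[of Z "fst (snd u) b" "fst (snd E) b"]
      E(3) b U(4,5)[OF b] triv[OF b] FC_arr(4)[OF E(1) b] by auto
  then have "\<exists>g \<in> hom FC (fst u) (fst E). E \<cdot>\<^bsub>FC\<^esub> g = u"
    using E(3) ED(2) by (intro FC_factor_through_pointwise_mono[OF E(1) _ u]) (simp_all add: coreflection_def)
  then obtain g where g: "g \<in> hom FC (fst u) (fst E)" "E \<cdot>\<^bsub>FC\<^esub> g = u"
    by blast
  then show ?thesis
    using FC.trivialI[of g E "functor_class B C Z"] ED by (simp add: FC_hom_iff)
qed

text \<open>Limits chosen separately at each object assemble to a functor, because each arrow of \<open>B\<close> maps
  the limit cone at its domain to a cone at its codomain.\<close>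

lemma FC_pointwise_limit:
  assumes D: "is_functor J FC D"
    and lim: "\<And>b. b \<in> Obj B \<Longrightarrow> \<exists>l p. is_limit J C (compose_functor (evaluation b) D) l p"
  obtains L P where "is_limit J FC D L P"
    "\<And>b. b \<in> Obj B \<Longrightarrow> is_limit J C (compose_functor (evaluation b) D) (fobj L b) (\<lambda>i. fst (snd (P i)) b)"
proof -
  interpret J: category J using functorD(1)[OF D] .
  obtain l p where lp: "\<And>b. b \<in> Obj B \<Longrightarrow> is_limit J C (compose_functor (evaluation b) D) (l b) (p b)"
    using lim by metis
  have p: "l b \<in> Obj C" "i \<in> Obj J \<Longrightarrow> p b i \<in> Arr C" "i \<in> Obj J \<Longrightarrow> Dom C (p b i) = l b"
      "i \<in> Obj J \<Longrightarrow> Cod C (p b i) = fobj (fobj D i) b"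
      "u \<in> Arr J \<Longrightarrow> fst (snd (farr D u)) b \<cdot>\<^bsub>C\<^esub> p b (Dom J u) = p b (Cod J u)" if "b \<in> Obj B" for b i u
    using coneD[OF limit_cone[OF lp[OF that]]] by simp_all
  note DD = functorD[OF D]
  have Di: "fobj D i \<in> Obj FC" if "i \<in> Obj J" for i using DD(3)[OF that] .
  have Du: "farr D u \<in> Arr FC" "fst (farr D u) = fobj D (Dom J u)" "snd (snd (farr D u)) = fobj D (Cod J u)"
    if "u \<in> Arr J" for u
    using DD(4-6)[OF that] by simp_all
  have cancel: "h = h'" if "b \<in> Obj B" "h \<in> hom C x (l b)" "h' \<in> hom C x (l b)"
      "\<And>i. i \<in> Obj J \<Longrightarrow> p b i \<cdot>\<^bsub>C\<^esub> h = p b i \<cdot>\<^bsub>C\<^esub> h'" for b h h' x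
    by (rule limit_jointly_monic[OF C.category_axioms lp[OF that(1)] J.category_axioms
          compose_is_functor[OF D evaluation_functor[OF that(1)]] that(2-4)])
  let ?R = "\<lambda>\<beta> h. \<forall>i \<in> Obj J. p (Cod B \<beta>) i \<cdot>\<^bsub>C\<^esub> h = farr (fobj D i) \<beta> \<cdot>\<^bsub>C\<^esub> p (Dom B \<beta>) i"
  obtain L where L: "L \<in> Obj FC" "\<And>b. b \<in> Obj B \<Longrightarrow> fobj L b = l b"
    "\<And>\<beta>. \<beta> \<in> Arr B \<Longrightarrow> ?R \<beta> (farr L \<beta>)"
  proof (rule FC_functor_by_unique_arrows[of l ?R])
    fix \<beta> assume \<beta>: "\<beta> \<in> Arr B"
    note d = B.dom_in_obj[OF \<beta>] and c = B.cod_in_obj[OF \<beta>]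
    have "is_cone J C (compose_functor (evaluation (Cod B \<beta>)) D) (l (Dom B \<beta>))
        (\<lambda>i. farr (fobj D i) \<beta> \<cdot>\<^bsub>C\<^esub> p (Dom B \<beta>) i)"
      unfolding is_cone_def
    proof (intro conjI ballI)
      fix i assume i: "i \<in> Obj J"
      show "farr (fobj D i) \<beta> \<cdot>\<^bsub>C\<^esub> p (Dom B \<beta>) i
          \<in> hom C (l (Dom B \<beta>)) (fobj (compose_functor (evaluation (Cod B \<beta>)) D) i)"
        using p(2-4)[OF d i] FC_obj(3-5)[OF Di[OF i] \<beta>] by (simp add: C.cat_simps)
    next
      fix u assume u: "u \<in> Arr J"
      note di = J.dom_in_obj[OF u] and ci = J.cod_in_obj[OF u]
      note ty = p(2-4)[OF d di] FC_obj(3-5)[OF Di[OF di] \<beta>] FC_obj(3-5)[OF Di[OF ci] \<beta>]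
        FC_arr(3-5)[OF Du(1)[OF u] d] FC_arr(3-5)[OF Du(1)[OF u] c] Du(2,3)[OF u]
      let ?v = "fst (snd (farr D u))"
      have "?v (Cod B \<beta>) \<cdot>\<^bsub>C\<^esub> (farr (fobj D (Dom J u)) \<beta> \<cdot>\<^bsub>C\<^esub> p (Dom B \<beta>) (Dom J u)) =
          (?v (Cod B \<beta>) \<cdot>\<^bsub>C\<^esub> farr (fobj D (Dom J u)) \<beta>) \<cdot>\<^bsub>C\<^esub> p (Dom B \<beta>) (Dom J u)"
        using ty by (simp add: C.assoc)
      also have "\<dots> = farr (fobj D (Cod J u)) \<beta> \<cdot>\<^bsub>C\<^esub> ?v (Dom B \<beta>) \<cdot>\<^bsub>C\<^esub> p (Dom B \<beta>) (Dom J u)"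
        using FC_arr(6)[OF Du(1)[OF u] \<beta>] Du(2,3)[OF u] by simp
      also have "\<dots> = farr (fobj D (Cod J u)) \<beta> \<cdot>\<^bsub>C\<^esub> p (Dom B \<beta>) (Cod J u)"
        unfolding p(5)[OF d u, symmetric] using ty by (simp add: C.assoc)
      finally show "farr (compose_functor (evaluation (Cod B \<beta>)) D) u \<cdot>\<^bsub>C\<^esub>
          (farr (fobj D (Dom J u)) \<beta> \<cdot>\<^bsub>C\<^esub> p (Dom B \<beta>) (Dom J u)) =
          farr (fobj D (Cod J u)) \<beta> \<cdot>\<^bsub>C\<^esub> p (Dom B \<beta>) (Cod J u)" by simp
    qed (use p(1)[OF d] in simp)
    from limit_factor[OF lp[OF c] this]
    show "\<exists>!h. h \<in> hom C (l (Dom B \<beta>)) (l (Cod B \<beta>)) \<and> ?R \<beta> h" .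
  next
    fix b assume b: "b \<in> Obj B"
    then show "?R (Id B b) (Id C (l b))"
      using p[OF b] FC_obj(6)[OF Di b] by (simp add: B.cat_simps C.cat_simps)
  next
    fix \<beta> \<gamma> h k
    assume \<beta>\<gamma>: "\<beta> \<in> Arr B" "\<gamma> \<in> Arr B" "Cod B \<beta> = Dom B \<gamma>"
      and h: "h \<in> hom C (l (Dom B \<beta>)) (l (Cod B \<beta>))" "?R \<beta> h"
      and k: "k \<in> hom C (l (Dom B \<gamma>)) (l (Cod B \<gamma>))" "?R \<gamma> k"
    have "p (Cod B \<gamma>) i \<cdot>\<^bsub>C\<^esub> (k \<cdot>\<^bsub>C\<^esub> h) = farr (fobj D i) (\<gamma> \<cdot>\<^bsub>B\<^esub> \<beta>) \<cdot>\<^bsub>C\<^esub> p (Dom B \<beta>) i"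
      if i: "i \<in> Obj J" for i
    proof -
      note ty = p(2-4)[OF B.dom_in_obj[OF \<beta>\<gamma>(1)] i] p(2-4)[OF B.cod_in_obj[OF \<beta>\<gamma>(1)] i]
        p(2-4)[OF B.cod_in_obj[OF \<beta>\<gamma>(2)] i] FC_obj(3-5)[OF Di[OF i] \<beta>\<gamma>(1)] FC_obj(3-5)[OF Di[OF i] \<beta>\<gamma>(2)]
      have "p (Cod B \<gamma>) i \<cdot>\<^bsub>C\<^esub> (k \<cdot>\<^bsub>C\<^esub> h) = farr (fobj D i) \<gamma> \<cdot>\<^bsub>C\<^esub> p (Dom B \<gamma>) i \<cdot>\<^bsub>C\<^esub> h"
        using ty h(1) k \<beta>\<gamma>(3) i by (simp add: C.hom_iff flip: C.assoc)
      also have "\<dots> = farr (fobj D i) \<gamma> \<cdot>\<^bsub>C\<^esub> farr (fobj D i) \<beta> \<cdot>\<^bsub>C\<^esub> p (Dom B \<beta>) i"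
        using ty h k(1) \<beta>\<gamma>(3) i by (simp add: C.hom_iff C.assoc)
      finally show ?thesis using \<beta>\<gamma> FC_obj(7)[OF Di[OF i]] by simp
    qed
    then show "?R (\<gamma> \<cdot>\<^bsub>B\<^esub> \<beta>) (k \<cdot>\<^bsub>C\<^esub> h)" using \<beta>\<gamma> by (simp add: B.comp_typing)
  qed (use p(1) in auto)
  define P where "P i = (L, restrict (\<lambda>b. p b i) (Obj B), fobj D i)" for i
  have P: "P i \<in> Arr FC" "fst (P i) = L" "snd (snd (P i)) = fobj D i"
    "b \<in> Obj B \<Longrightarrow> fst (snd (P i)) b = p b i" if "i \<in> Obj J" for i b
    unfolding P_def by ((rule FC_arrI)?; use L Di that p in \<open>simp add: C.hom_iff\<close>)+
  have "is_limit J FC D L P"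
  proof (rule limitI)
    show "is_cone J FC D L P"
      unfolding is_cone_def
    proof (intro conjI ballI)
      fix u assume u: "u \<in> Arr J"
      note PD = P[OF J.dom_in_obj[OF u]] and PC = P[OF J.cod_in_obj[OF u]]
      show "farr D u \<cdot>\<^bsub>FC\<^esub> P (Dom J u) = P (Cod J u)"
      proof (rule FC_arr_eqI[OF FC_comp_arr[OF PD(1) Du(1)[OF u]] PC(1)])
        show "snd (snd (P (Dom J u))) = fst (farr D u)" using PD Du(2)[OF u] by simp
        show "fst (farr D u \<cdot>\<^bsub>FC\<^esub> P (Dom J u)) = fst (P (Cod J u))" using PD PC by simp
        show "snd (snd (farr D u \<cdot>\<^bsub>FC\<^esub> P (Dom J u))) = snd (snd (P (Cod J u)))"
          using Du(3)[OF u] PC by simp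
        show "fst (snd (farr D u \<cdot>\<^bsub>FC\<^esub> P (Dom J u))) b = fst (snd (P (Cod J u))) b" if b: "b \<in> Obj B" for b
          using PD(4)[OF b] PC(4)[OF b] p(5)[OF b u] b by simp
      qed
    qed (use P L(1) in \<open>simp_all add: FC_hom_iff\<close>)
    fix X Q assume Q: "is_cone J FC D X Q"
    note QD = coneD[OF Q]
    have X: "X \<in> Obj FC" using QD(1) .
    have Qi: "Q i \<in> Arr FC" "fst (Q i) = X" "snd (snd (Q i)) = fobj D i" if "i \<in> Obj J" for i
      using QD(2-4)[OF that] by simp_all
    have "\<exists>!h. h \<in> hom C (fobj X b) (l b) \<and> (\<forall>i \<in> Obj J. p b i \<cdot>\<^bsub>C\<^esub> h = fst (snd (Q i)) b)"
      if b: "b \<in> Obj B" for b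
    proof (rule limit_factor[OF lp[OF b]])
      show "is_cone J C (compose_functor (evaluation b) D) (fobj X b) (\<lambda>i. fst (snd (Q i)) b)"
        unfolding is_cone_def
      proof (intro conjI ballI)
        fix u assume u: "u \<in> Arr J"
        have "fst (snd (farr D u \<cdot>\<^bsub>FC\<^esub> Q (Dom J u))) b = fst (snd (Q (Cod J u))) b"
          using QD(5)[OF u] by simp
        then show "farr (compose_functor (evaluation b) D) u \<cdot>\<^bsub>C\<^esub> fst (snd (Q (Dom J u))) b =
            fst (snd (Q (Cod J u))) b"
          using b by simp
      qed (use b FC_obj(2)[OF X] FC_arr(3-5)[OF Qi(1)] Qi in \<open>simp_all add: C.hom_iff\<close>)
    qed
    then obtain h where h: "\<And>b. b \<in> Obj B \<Longrightarrow> h b \<in> hom C (fobj X b) (l b)"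
      and ph: "\<And>b i. \<lbrakk>b \<in> Obj B; i \<in> Obj J\<rbrakk> \<Longrightarrow> p b i \<cdot>\<^bsub>C\<^esub> h b = fst (snd (Q i)) b"
      by metis
    have h': "h b \<in> Arr C" "Dom C (h b) = fobj X b" "Cod C (h b) = l b" if "b \<in> Obj B" for b
      using h[OF that] by (simp_all add: C.hom_iff)
    let ?H = "(X, restrict h (Obj B), L)"
    have H: "?H \<in> Arr FC"
    proof (rule FC_arrI[OF X L(1)])
      fix \<beta> assume \<beta>: "\<beta> \<in> Arr B"
      note d = B.dom_in_obj[OF \<beta>] and c = B.cod_in_obj[OF \<beta>]
      note ty = h'[OF d] h'[OF c] FC_obj(3-5)[OF X \<beta>] FC_obj(3-5)[OF L(1) \<beta>] L(2)[OF d] L(2)[OF c]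
      show "h (Cod B \<beta>) \<cdot>\<^bsub>C\<^esub> farr X \<beta> = farr L \<beta> \<cdot>\<^bsub>C\<^esub> h (Dom B \<beta>)"
      proof (rule cancel[OF c, where x = "fobj X (Dom B \<beta>)"])
        fix i assume i: "i \<in> Obj J"
        note ty' = p(2-4)[OF d i] p(2-4)[OF c i] FC_obj(3-5)[OF Di[OF i] \<beta>]
        have "p (Cod B \<beta>) i \<cdot>\<^bsub>C\<^esub> (h (Cod B \<beta>) \<cdot>\<^bsub>C\<^esub> farr X \<beta>) = fst (snd (Q i)) (Cod B \<beta>) \<cdot>\<^bsub>C\<^esub> farr X \<beta>"
          using ty ty' ph[OF c i] by (simp flip: C.assoc)
        also have "\<dots> = farr (fobj D i) \<beta> \<cdot>\<^bsub>C\<^esub> (p (Dom B \<beta>) i \<cdot>\<^bsub>C\<^esub> h (Dom B \<beta>))"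
          using FC_arr(6)[OF Qi(1)[OF i] \<beta>] Qi[OF i] ph[OF d i] by simp
        also have "\<dots> = farr (fobj D i) \<beta> \<cdot>\<^bsub>C\<^esub> p (Dom B \<beta>) i \<cdot>\<^bsub>C\<^esub> h (Dom B \<beta>)"
          using ty ty' by (simp add: C.assoc)
        also have "\<dots> = p (Cod B \<beta>) i \<cdot>\<^bsub>C\<^esub> farr L \<beta> \<cdot>\<^bsub>C\<^esub> h (Dom B \<beta>)"
          using L(3)[OF \<beta>] i by simp
        also have "\<dots> = p (Cod B \<beta>) i \<cdot>\<^bsub>C\<^esub> (farr L \<beta> \<cdot>\<^bsub>C\<^esub> h (Dom B \<beta>))"
          using ty ty' by (simp add: C.assoc)
        finally show "p (Cod B \<beta>) i \<cdot>\<^bsub>C\<^esub> (h (Cod B \<beta>) \<cdot>\<^bsub>C\<^esub> farr X \<beta>) =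
            p (Cod B \<beta>) i \<cdot>\<^bsub>C\<^esub> (farr L \<beta> \<cdot>\<^bsub>C\<^esub> h (Dom B \<beta>))" .
      qed (use ty in \<open>simp_all add: C.cat_simps\<close>)
    qed (use h L(2) in simp)
    show "\<exists>!h. h \<in> hom FC X L \<and> (\<forall>i \<in> Obj J. P i \<cdot>\<^bsub>FC\<^esub> h = Q i)"
    proof
      have "P i \<cdot>\<^bsub>FC\<^esub> ?H = Q i" if i: "i \<in> Obj J" for i
        by (rule FC_arr_eqI[OF FC_comp_arr[OF H P(1)[OF i]] Qi(1)[OF i]])
          (use P[OF i] Qi[OF i] ph[OF _ i] in simp_all)
      then show "?H \<in> hom FC X L \<and> (\<forall>i \<in> Obj J. P i \<cdot>\<^bsub>FC\<^esub> ?H = Q i)"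
        using H by (simp add: FC_hom_iff)
      fix G assume G: "G \<in> hom FC X L \<and> (\<forall>i \<in> Obj J. P i \<cdot>\<^bsub>FC\<^esub> G = Q i)"
      then have G': "G \<in> Arr FC" "fst G = X" "snd (snd G) = L" by (simp_all add: FC_hom_iff)
      show "G = ?H"
      proof (rule FC_arr_eqI[OF G'(1) H])
        fix b assume b: "b \<in> Obj B"
        have "fst (snd G) b = h b"
        proof (rule cancel[OF b, where x = "fobj X b"])
          fix i assume i: "i \<in> Obj J"
          have "fst (snd (P i \<cdot>\<^bsub>FC\<^esub> G)) b = fst (snd (Q i)) b" using G i by simp
          then show "p b i \<cdot>\<^bsub>C\<^esub> fst (snd G) b = p b i \<cdot>\<^bsub>C\<^esub> h b"
            using b P(4)[OF i b] ph[OF b i] by simp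
        qed (use FC_arr(3-5)[OF G'(1) b] G' L(2)[OF b] h[OF b] in \<open>simp_all add: C.hom_iff\<close>)
        then show "fst (snd G) b = fst (snd ?H) b" using b by simp
      qed (use G' in simp_all)
    qed
  qed
  moreover have "is_limit J C (compose_functor (evaluation b) D) (fobj L b) (\<lambda>i. fst (snd (P i)) b)"
    if b: "b \<in> Obj B" for b
    unfolding L(2)[OF b]
    by (rule limit_cong[OF J.category_axioms lp[OF b]]) (use P(4) b in simp)
  ultimately show ?thesis using that by blast
qed

lemma FC_pointwise_finite_limit:
  assumes lim: "has_finite_limits C" and J: "finite (Obj J)" "finite (Arr J)" and D: "is_functor J FC D"
  obtains L P where "is_limit J FC D L P"
    "\<And>b. b \<in> Obj B \<Longrightarrow> is_limit J C (compose_functor (evaluation b) D) (fobj L b) (\<lambda>i. fst (snd (P i)) b)"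
proof -
  have "\<exists>l p. is_limit J C (compose_functor (evaluation b) D) l p" if "b \<in> Obj B" for b
    using finite_limits_of_any_type[OF lim J compose_is_functor[OF D evaluation_functor[OF that]]] by metis
  from FC_pointwise_limit[OF D this] show ?thesis using that by metis
qed

lemma FC_cokernel_if_pointwise:
  assumes core: "\<And>y. y \<in> Obj C \<Longrightarrow> \<exists>e. coreflection C Z y e"
    and k: "k \<in> Arr FC" and q: "q \<in> Arr FC" "fst q = snd (snd k)"
    and coker: "\<And>b. b \<in> Obj B \<Longrightarrow> is_Z_cokernel C Z (fst (snd k) b) (fst (snd q) b)"
  shows "is_Z_cokernel FC (functor_class B C Z) k q"
proof (rule cokernelI)
  note K = FC_arr[OF k] and Q = FC_arr[OF q(1)]
  show "Z_trivial FC (functor_class B C Z) (q \<cdot>\<^bsub>FC\<^esub> k)"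
    by (rule FC_trivial_if_pointwise_trivial[OF core FC_comp_arr[OF k q(1)]])
      (use q(2) cokernelD(4)[OF coker] in simp_all)
  fix x
  assume x: "x \<in> Arr FC" "Dom FC x = Cod FC k" and triv: "Z_trivial FC (functor_class B C Z) (x \<cdot>\<^bsub>FC\<^esub> k)"
  have "\<exists>!g. g \<in> hom FC (snd (snd q)) (snd (snd x)) \<and> g \<cdot>\<^bsub>FC\<^esub> q = x"
  proof (rule FC_factor_through_pointwise_epi[OF q(1) _ x(1)])
    show "s = t" if "b \<in> Obj B" "s \<in> Arr C" "t \<in> Arr C" "Dom C s = fobj (snd (snd q)) b"
      "Dom C t = fobj (snd (snd q)) b" "Cod C s = Cod C t"
      "s \<cdot>\<^bsub>C\<^esub> fst (snd q) b = t \<cdot>\<^bsub>C\<^esub> fst (snd q) b" for b s t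
      by (rule C.cokernel_epi[OF coker[OF that(1)]]) (use that Q(5) in simp_all)
    fix b assume b: "b \<in> Obj B"
    have "Z_trivial C Z (fst (snd x) b \<cdot>\<^bsub>C\<^esub> fst (snd k) b)"
      using FC_trivial_pointwise[OF triv b] b by simp
    from cokernel_factor[OF coker[OF b] FC_arr(3)[OF x(1) b] _ this]
    have "\<exists>!u. u \<in> hom C (fobj (snd (snd q)) b) (fobj (snd (snd x)) b) \<and> u \<cdot>\<^bsub>C\<^esub> fst (snd q) b = fst (snd x) b"
      using x(2) FC_arr(4,5)[OF x(1) b] K(5)[OF b] Q(5)[OF b] by simp
    then show "\<exists>g \<in> hom C (fobj (snd (snd q)) b) (fobj (snd (snd x)) b). g \<cdot>\<^bsub>C\<^esub> fst (snd q) b = fst (snd x) b"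
      by blast
  qed (use x(2) q(2) in simp)
  then show "\<exists>!u. u \<in> hom FC (Cod FC q) (Cod FC x) \<and> u \<cdot>\<^bsub>FC\<^esub> q = x" by simp
qed (use k q in simp_all)

text \<open>The action of \<open>\<beta>\<close> on the quotients is the factorization of \<open>q\<^sub>c \<cdot> F \<beta>\<close> through \<open>q\<^sub>d\<close>, where
  \<open>\<beta>\<close> goes from \<open>d\<close> to \<open>c\<close> and \<open>k : K \<rightarrow> F\<close>. It exists because \<open>q\<^sub>c \<cdot> F \<beta> \<cdot> k\<^sub>d = q\<^sub>c \<cdot> k\<^sub>c \<cdot> K \<beta>\<close>, by
  naturality of \<open>k\<close>, is trivial.\<close>

lemma FC_cokernel_lift:
  assumes k: "k \<in> Arr FC"
    and ex: "\<And>b. b \<in> Obj B \<Longrightarrow> \<exists>q. is_Z_cokernel C Z (fst (snd k) b) q"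
  shows "\<exists>q \<in> Arr FC. fst q = snd (snd k) \<and>
    (\<forall>b \<in> Obj B. is_Z_cokernel C Z (fst (snd k) b) (fst (snd q) b))"
proof -
  note K = FC_arr[OF k]
  note F = FC_obj[OF K(2)] and F' = FC_obj[OF K(1)]
  let ?F = "snd (snd k)"
  obtain q where q: "\<And>b. b \<in> Obj B \<Longrightarrow> is_Z_cokernel C Z (fst (snd k) b) (q b)"
    using ex by metis
  have q': "q b \<in> Arr C" "Dom C (q b) = fobj ?F b" "Z_trivial C Z (q b \<cdot>\<^bsub>C\<^esub> fst (snd k) b)" if "b \<in> Obj B" for b
    using cokernelD[OF q[OF that]] K(5)[OF that] by simp_all
  let ?R = "\<lambda>\<beta> h. h \<cdot>\<^bsub>C\<^esub> q (Dom B \<beta>) = q (Cod B \<beta>) \<cdot>\<^bsub>C\<^esub> farr ?F \<beta>"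
  obtain L where L: "L \<in> Obj FC" "\<And>b. b \<in> Obj B \<Longrightarrow> fobj L b = Cod C (q b)"
    "\<And>\<beta>. \<beta> \<in> Arr B \<Longrightarrow> ?R \<beta> (farr L \<beta>)"
  proof (rule FC_functor_by_unique_arrows[of "\<lambda>b. Cod C (q b)" ?R])
    fix \<beta> assume \<beta>: "\<beta> \<in> Arr B"
    note d = B.dom_in_obj[OF \<beta>] and c = B.cod_in_obj[OF \<beta>]
    let ?x = "q (Cod B \<beta>) \<cdot>\<^bsub>C\<^esub> farr ?F \<beta>"
    note ty = q'(1,2)[OF d] q'(1,2)[OF c] F(3-5)[OF \<beta>] F'(3-5)[OF \<beta>] K(3-5)[OF d] K(3-5)[OF c]
    have x: "?x \<in> Arr C" "Dom C ?x = fobj ?F (Dom B \<beta>)" "Cod C ?x = Cod C (q (Cod B \<beta>))"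
      using ty by (simp_all add: C.comp_typing)
    have "?x \<cdot>\<^bsub>C\<^esub> fst (snd k) (Dom B \<beta>) = q (Cod B \<beta>) \<cdot>\<^bsub>C\<^esub> (farr ?F \<beta> \<cdot>\<^bsub>C\<^esub> fst (snd k) (Dom B \<beta>))"
      using ty by (simp add: C.assoc)
    also have "\<dots> = q (Cod B \<beta>) \<cdot>\<^bsub>C\<^esub> fst (snd k) (Cod B \<beta>) \<cdot>\<^bsub>C\<^esub> farr (fst k) \<beta>"
      unfolding K(6)[OF \<beta>, symmetric] using ty by (simp add: C.assoc)
    finally have "Z_trivial C Z (?x \<cdot>\<^bsub>C\<^esub> fst (snd k) (Dom B \<beta>))"
      using C.trivial_comp_right[OF q'(3)[OF c], of "farr (fst k) \<beta>"] ty by (simp add: C.comp_typing)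
    from cokernel_factor[OF q[OF d] x(1) _ this]
    show "\<exists>!h. h \<in> hom C (Cod C (q (Dom B \<beta>))) (Cod C (q (Cod B \<beta>))) \<and> ?R \<beta> h"
      using x K(5)[OF d] by simp
  next
    fix b assume "b \<in> Obj B"
    then show "?R (Id B b) (Id C (Cod C (q b)))"
      using q' F(6) by (simp add: B.cat_simps C.cat_simps)
  next
    fix \<beta> \<gamma> h k
    assume \<beta>\<gamma>: "\<beta> \<in> Arr B" "\<gamma> \<in> Arr B" "Cod B \<beta> = Dom B \<gamma>"
      and h: "h \<in> hom C (Cod C (q (Dom B \<beta>))) (Cod C (q (Cod B \<beta>)))" "?R \<beta> h"
      and k: "k \<in> hom C (Cod C (q (Dom B \<gamma>))) (Cod C (q (Cod B \<gamma>)))" "?R \<gamma> k"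
    note ty = q'(1,2)[OF B.dom_in_obj[OF \<beta>\<gamma>(1)]] q'(1,2)[OF B.cod_in_obj[OF \<beta>\<gamma>(1)]]
      q'(1,2)[OF B.cod_in_obj[OF \<beta>\<gamma>(2)]] F(3-5)[OF \<beta>\<gamma>(1)] F(3-5)[OF \<beta>\<gamma>(2)]
    have "k \<cdot>\<^bsub>C\<^esub> h \<cdot>\<^bsub>C\<^esub> q (Dom B \<beta>) = k \<cdot>\<^bsub>C\<^esub> q (Dom B \<gamma>) \<cdot>\<^bsub>C\<^esub> farr ?F \<beta>"
      using ty h k(1) \<beta>\<gamma>(3) by (simp add: C.hom_iff C.assoc)
    also have "\<dots> = q (Cod B \<gamma>) \<cdot>\<^bsub>C\<^esub> (farr ?F \<gamma> \<cdot>\<^bsub>C\<^esub> farr ?F \<beta>)"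
      using ty k \<beta>\<gamma>(3) by (simp add: C.hom_iff C.assoc)
    finally show "?R (\<gamma> \<cdot>\<^bsub>B\<^esub> \<beta>) (k \<cdot>\<^bsub>C\<^esub> h)"
      using \<beta>\<gamma> F(7) by (simp add: B.comp_typing)
  qed (use q' in \<open>auto simp: C.cod_in_obj\<close>)
  have "(?F, restrict q (Obj B), L) \<in> Arr FC"
    by (rule FC_arrI) (use L K(2) q' in \<open>simp_all add: C.hom_iff\<close>)
  then show ?thesis using q by (intro bexI[of _ "(?F, restrict q (Obj B), L)"]) simp_all
qed

lemma functor_class_iso_closed:
  assumes iso: "\<And>x y. \<lbrakk>x \<in> Z; isomorphic C x y\<rbrakk> \<Longrightarrow> y \<in> Z"
    and F: "F \<in> functor_class B C Z" and FG: "isomorphic FC F G"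
  shows "G \<in> functor_class B C Z"
proof -
  obtain f g where "f \<in> hom FC F G" "g \<in> hom FC G F"
    and gf: "g \<cdot>\<^bsub>FC\<^esub> f = Id FC F" "f \<cdot>\<^bsub>FC\<^esub> g = Id FC G" and G: "G \<in> Obj FC" "F \<in> Obj FC"
    using FG unfolding isomorphic_def by blast
  then have f: "f \<in> Arr FC" "fst f = F" "snd (snd f) = G" and g: "g \<in> Arr FC" "fst g = G" "snd (snd g) = F"
    by (simp_all add: FC_hom_iff)
  have "fobj G b \<in> Z" if b: "b \<in> Obj B" for b
  proof -
    have "fst (snd (g \<cdot>\<^bsub>FC\<^esub> f)) b = fst (snd (Id FC F)) b" "fst (snd (f \<cdot>\<^bsub>FC\<^esub> g)) b = fst (snd (Id FC G)) b"
      using gf by simp_all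
    then have "fst (snd g) b \<cdot>\<^bsub>C\<^esub> fst (snd f) b = Id C (fobj F b)"
      "fst (snd f) b \<cdot>\<^bsub>C\<^esub> fst (snd g) b = Id C (fobj G b)"
      using b by simp_all
    moreover have "fst (snd f) b \<in> hom C (fobj F b) (fobj G b)" "fst (snd g) b \<in> hom C (fobj G b) (fobj F b)"
      using FC_arr(3-5)[OF f(1) b] FC_arr(3-5)[OF g(1) b] f g by (simp_all add: C.hom_iff)
    ultimately have "isomorphic C (fobj F b) (fobj G b)"
      using FC_obj(2)[OF G(1) b] FC_obj(2)[OF G(2) b] unfolding isomorphic_def by blast
    then show ?thesis using iso F b by (auto simp: functor_class_iff)
  qed
  then show ?thesis using G by (simp add: functor_class_iff)
qed

lemma functor_category_prenormal:
  assumes C: "prenormal C Z"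
  shows "prenormal FC (functor_class B C Z)"
proof (rule prenormal_by_joint_reflection[where I = "Obj B" and U = evaluation, OF C FC_category])
  note CD = C.prenormalD[OF C]
  have core: "\<exists>e. coreflection C Z y e" if "y \<in> Obj C" for y
    using C.mono_coreflectiveD[OF CD(1) that] by blast
  show "functor_class B C Z \<subseteq> Obj FC" by (auto simp: functor_class_iff)
  have "\<And>x y. \<lbrakk>x \<in> Z; isomorphic C x y\<rbrakk> \<Longrightarrow> y \<in> Z"
    using CD(1) unfolding mono_coreflective_def by blast
  then show "\<And>F G. \<lbrakk>F \<in> functor_class B C Z; isomorphic FC F G\<rbrakk> \<Longrightarrow> G \<in> functor_class B C Z"
    using functor_class_iso_closed by blast
  show "has_finite_limits FC"
    unfolding has_finite_limits_def
  proof (intro allI impI, elim conjE)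
    fix J :: "(nat, nat) category" and D
    assume "finite (Obj J)" "finite (Arr J)" "is_functor J FC D"
    from FC_pointwise_finite_limit[OF CD(2) this] show "\<exists>l p. is_limit J FC D l p" by blast
  qed
  show "\<And>b. b \<in> Obj B \<Longrightarrow> is_functor FC C (evaluation b)" by (rule evaluation_functor)
  show "\<exists>e. coreflection FC (functor_class B C Z) F e \<and>
      (\<forall>b \<in> Obj B. coreflection C Z (fobj (evaluation b) F) (farr (evaluation b) e))"
    if "F \<in> Obj FC" for F
    using FC_pointwise_coreflection[OF core that] unfolding evaluation_sel by metis
  show "is_pullback C (farr (evaluation b) f) (farr (evaluation b) g) (farr (evaluation b) g')
      (farr (evaluation b) f')"
    if b: "b \<in> Obj B" and pb: "is_pullback FC f g g' f'" for b f g g' f'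
  proof (rule preserves_pullbacks_if_preserves_some_limit[OF evaluation_functor[OF b] pb])
    fix D assume D: "is_functor cospan FC D"
    show "\<exists>l p. is_limit cospan FC D l p \<and> is_limit cospan C (compose_functor (evaluation b) D)
        (fobj (evaluation b) l) (\<lambda>i. farr (evaluation b) (p i))"
      using FC_pointwise_finite_limit[OF CD(2) cospan_finite D] b unfolding evaluation_sel by metis
  qed
  show "\<exists>q \<in> Arr FC. Dom FC q = Cod FC k \<and>
      (\<forall>b \<in> Obj B. is_Z_cokernel C Z (farr (evaluation b) k) (farr (evaluation b) q))"
    if "is_Z_kernel FC (functor_class B C Z) f k"
      "\<forall>b \<in> Obj B. \<exists>q. is_Z_cokernel C Z (farr (evaluation b) k) q" for f k
    using FC_cokernel_lift[OF kernelD(2)[OF that(1)]] that(2) by simp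
  show "is_Z_cokernel FC (functor_class B C Z) k q"
    if "k \<in> Arr FC" "q \<in> Arr FC" "Dom FC q = Cod FC k"
      "\<forall>b \<in> Obj B. is_Z_cokernel C Z (farr (evaluation b) k) (farr (evaluation b) q)" for k q
    using FC_cokernel_if_pointwise[OF core that(1,2)] that(3,4) by simp
qed

end

theorem proposition6p6:
  fixes C :: "('o, 'a) category" and Z :: "'o set"
  assumes "prenormal C Z"
  shows "(\<forall>c \<in> Obj C. prenormal (slice C c) (slice_class C Z c)) \<and>
         (\<forall>B :: ('p, 'b) category. category B \<longrightarrow>
            prenormal (functor_category B C) (functor_class B C Z))"
proof (intro conjI ballI allI impI)
  have C: "category C" using assms unfolding prenormal_def by blast
  fix c assume "c \<in> Obj C"
  then show "prenormal (slice C c) (slice_class C Z c)"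
    using category.slice_prenormal[OF C assms] by blast
next
  have C: "category C" using assms unfolding prenormal_def by blast
  fix B :: "('p, 'b) category" assume "category B"
  then interpret functor_category_setup B C using C by (simp add: functor_category_setup_def)
  show "prenormal (functor_category B C) (functor_class B C Z)"
    using functor_category_prenormal[OF assms] .
qed

end
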